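(* Let $(\mathcal{G},\mathbf{p}^* )$ be the target formation with $l$ stationary leaders ($2\le l<n$), let the followers $i=l+1,\dots,n$ obey $\dot{\mathbf p}_i=\mathbf u_i+\mathbf d_i$, put $\boldsymbol\delta=\mathbf p-\mathbf p^*$, and suppose that for some positive integer $N$ and unknown positive constants $\beta_0,\dots,\beta_N$, $$\|\mathbf d(t)\|_\infty\le\sum_{r=0}^N\beta_r\|\boldsymbol\delta(t)\|_1^r\qquad\forall t\ge0 .$$ Consider the adaptive control law $$\mathbf u_i=-\sum_{j\in\mathcal N_i}\gamma_{ij}(t)\mathbf P_{\mathbf g_{ij}^*}\,\mathrm{sgn}(\mathbf q_{ij}),\quad \mathbf q_{ij}=\mathbf P_{\mathbf g_{ij}^*}(\mathbf p_i-\mathbf p_j),\quad \gamma_{ij}(t)=\sum_{r=0}^N\hat\beta_r^{ij}(t)\|\mathbf q_{ij}\|_1^r,$$ $$\dot{\hat\beta}{}_r^{ij}(t)=\|\mathbf q_{ij}\|_1^{r+1},\quad \hat\beta_r^{ij}(0)>0,\qquad r=0,\dots,N,\ (i,j)\in\mathcal E,$$ under the standing assumptions listed in the context. Let $\hat{\boldsymbol\beta}_r=[\hat\beta_r^1,\dots,\hat\beta_r^m]^\top$. Then for every Filippov solution on $[0,\infty)$, $\boldsymbol\delta$ and $\hat{\boldsymbol\beta}_r$ ($r=0,\dots,N$) are uniformly bounded, $\mathbf p(t)\to\mathbf p^*$ as $t\to\infty$, and $\lim_{t\to\infty}\hat{\boldsymbol\beta}_r(t)$ exists for all $r=0,\dots,N$.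 Further, let $\bar\beta_r$ be constants with $\bar\beta_r>\beta_r\left(\sqrt{\dfrac{dn}{\lambda_{\min}(\mathbf L_{ff}^* )}}\right)^{r+1}$, $r=0,\dots,N$; if at some time $T\ge 0$ one has $\hat{\boldsymbol\beta}_r(T)>\bar\beta_r\mathbf 1_m$ elementwise for all $r=0,\dots,N$, then $\mathbf p(t)\to\mathbf p^*$ in finite time (there is $T'<\infty$ with $\mathbf p(t)=\mathbf p^*$ for all $t\ge T'$).
   Context: Setting. $d\ge 2$; $\mathcal G=(\mathcal V,\mathcal E)$ is an undirected graph without self-loops, $|\mathcal V|=n$, $|\mathcal E|=m$, edges indexed $e_1,\dots,e_m$ and arbitrarily oriented; $\mathcal N_i$ is the neighbor set of $i$. Agent $i$ has position $\mathbf p_i(t)\in\mathbb R^d$ (all in a common orientation), $\mathbf p=[\mathbf p_1^\top,\dots,\mathbf p_n^\top]^\top$. Agents $1,\dots,l$ are leaders, $l+1,\dots,n$ followers, $f=n-l$. Bearing rigidity. For a configuration with distinct points, $\mathbf z_{ij}=\mathbf p_j-\mathbf p_i$, $\mathbf g_{ij}=\mathbf z_{ij}/\|\mathbf z_{ij}\|$, and $\mathbf P_{\mathbf g}=\mathbf I_d-\mathbf g\mathbf g^\top$ for a unit vector $\mathbf g$; for an edge $e_k=(i,j)$ write $\mathbf g_k=\mathbf g_{ij}$. $\mathbf H=[h_{ki}]\in\mathbb R^{m\times n}$ is the incidence matrix ($h_{ki}=-1$ if $i$ is the start vertex of $e_k$, $+1$ if the end vertex, $0$ otherwise), $\bar{\mathbf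 H}=\mathbf H\otimes\mathbf I_d$. $\tilde{\mathbf R}_b=\mathrm{blkdiag}(\mathbf P_{\mathbf g_k})\bar{\mathbf H}$ and the bearing Laplacian is $\mathbf L_b=\tilde{\mathbf R}_b^\top\tilde{\mathbf R}_b$. The formation is infinitesimally bearing rigid in $\mathbb R^d$ if $\mathrm{rank}(\tilde{\mathbf R}_b)=dn-d-1$. Target formation. $\mathbf p^*$ has distinct points, $(\mathcal G,\mathbf p^* )$ is infinitesimally bearing rigid in $\mathbb R^d$, and $\mathbf g_{ij}^*$ denote its bearing vectors. $\mathbf L_{ff}^*$ is the lower-right $df\times df$ (follower-follower) block of $\mathbf L_b$ evaluated at $\mathbf p^*$; it is known to be symmetric positive definite, with smallest eigenvalue $\lambda_{\min}(\mathbf L_{ff}^* )$. Leaders are stationary at their target positions: $\mathbf p_i(t)=\mathbf p_i^*$ for $i\le l$, $t\ge0$. Disturbance. $\mathbf d(t)=[\mathbf d_1(t)^\top,\dots,\mathbf d_n(t)^\top]^\top$ is uniformly continuous on $[0,\infty)$ and satisfies the polynomial bound in the claim along the solution considered. It is assumed that there is no collision between agents ($\mathbf p_i(t)\ne\mathbf p_j(t)$ for $i\neq j$). Conventions. $\mathrm{sgn}$ acts componentwise, with $\mathrm{sgn}(0)=0$; there is one set of gains per undirected edge: $\gamma_{ij}=\gamma_{ji}=\gamma_k$ and $\hat\beta_r^{ij}=\hat\beta_r^{ji}=\hat\beta_r^k$ for $e_k=(i,j)$. Solutions are in the Filippov sense: for the state $\mathbf x=(\mathbf p_{l+1},\dots,\mathbf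 p_n,\hat{\boldsymbol\beta}_0,\dots,\hat{\boldsymbol\beta}_N)$ with closed-loop right-hand side $F(t,\mathbf x)$, a solution is a locally absolutely continuous function with $\dot{\mathbf x}\in K[F](t,\mathbf x)$ for almost every $t$, where $K[F](t,\mathbf x)=\bigcap_{\epsilon>0}\bigcap_{\mu(S)=0}\overline{\mathrm{co}}\,F(t,B(\mathbf x,\epsilon)\setminus S)$ and $\mu$ is Lebesgue measure. *)

theory Defs
  imports "HOL-Analysis.Analysis"
begin

text \<open>
  Agents are the elements of a finite type; in the formation itself it is \<open>'l + 'f\<close>, with the
  leaders \<open>Inl a\<close> and the followers \<open>Inr b\<close>. A stacked vector of \<open>\<real>\<^sup>d\<close>-blocks indexed by \<open>'i\<close> has
  type \<open>(real^'d)^'i\<close>; matrices acting on such stacked vectors have index types \<open>'i \<times> 'd\<close>.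
\<close>

section \<open>Norms, signs and eigenvalues\<close>

text \<open>On the vector types used here \<open>Basis\<close> consists of the coordinate unit vectors, so that
  \<open>l1norm\<close> and the library's \<open>infnorm\<close> are the 1-norm and the \<open>\<infinity>\<close>-norm of the stacked vector.\<close>

definition l1norm :: "'a::euclidean_space \<Rightarrow> real" where
  "l1norm x = (\<Sum>b\<in>Basis. \<bar>x \<bullet> b\<bar>)"

text \<open>The overloaded \<open>sgn\<close> on \<open>real^'d\<close> normalises the whole vector; this one is componentwise.\<close>

definition sgn_vec :: "real^'d \<Rightarrow> real^'d" where
  "sgn_vec x = (\<chi> a. sgn (x $ a))"

definition eigenvalues :: "real^'n^'n \<Rightarrow> real set" where
  "eigenvalues A = {c. \<exists>v. v \<noteq> 0 \<and> A *v v = c *\<^sub>R v}"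

definition lambda_min :: "real^'n^'n \<Rightarrow> real" where
  "lambda_min A = Min (eigenvalues A)"

section \<open>Graphs\<close>

definition simple_graph :: "'v set set \<Rightarrow> bool" where
  "simple_graph E \<longleftrightarrow> (\<forall>\<epsilon>\<in>E. card \<epsilon> = 2)"

text \<open>\<open>e k = (i, j)\<close> is the \<open>k\<close>-th edge, with start vertex \<open>i\<close> and end vertex \<open>j\<close>.\<close>

definition oriented_edges :: "'v set set \<Rightarrow> ('m \<Rightarrow> 'v \<times> 'v) \<Rightarrow> bool" where
  "oriented_edges E e \<longleftrightarrow> bij_betw (\<lambda>k. {fst (e k), snd (e k)}) UNIV E"

definition nbrs :: "'v set set \<Rightarrow> 'v \<Rightarrow> 'v set" where
  "nbrs E i = {j. {i, j} \<in> E}"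

definition edge_index :: "('m \<Rightarrow> 'v \<times> 'v) \<Rightarrow> 'v \<Rightarrow> 'v \<Rightarrow> 'm" where
  "edge_index e i j = (THE k. {fst (e k), snd (e k)} = {i, j})"

definition incidence :: "('m::finite \<Rightarrow> 'v::finite \<times> 'v) \<Rightarrow> real^'v^'m" where
  "incidence e = (\<chi> k i. if i = fst (e k) then -1 else if i = snd (e k) then 1 else 0)"

section \<open>Bearing rigidity\<close>

definition bearing :: "(real^'d)^'v \<Rightarrow> 'v \<Rightarrow> 'v \<Rightarrow> real^'d" where
  "bearing p i j = (1 / norm (p $ j - p $ i)) *\<^sub>R (p $ j - p $ i)"

definition projector :: "real^'d \<Rightarrow> real^'d^'d" where
  "projector g = mat 1 - (\<chi> a b. g $ a * g $ b)"

definition kron_id ::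
  "real^'v::finite^'m::finite \<Rightarrow> real^('v \<times> 'd::finite)^('m \<times> 'd)" where
  "kron_id A = (\<chi> a b. A $ fst a $ fst b * (mat 1 :: real^'d^'d) $ snd a $ snd b)"

definition blkdiag ::
  "('m::finite \<Rightarrow> real^'d::finite^'d) \<Rightarrow> real^('m \<times> 'd)^('m \<times> 'd)" where
  "blkdiag M = (\<chi> a b. if fst a = fst b then M (fst a) $ snd a $ snd b else 0)"

definition rigidity_matrix ::
  "('m::finite \<Rightarrow> 'v::finite \<times> 'v) \<Rightarrow> (real^'d)^'v \<Rightarrow>
   real^('v \<times> 'd::finite)^('m \<times> 'd)" where
  "rigidity_matrix e p =
     blkdiag (\<lambda>k. projector (bearing p (fst (e k)) (snd (e k)))) ** kron_id (incidence e)"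

definition bearing_laplacian ::
  "('m::finite \<Rightarrow> 'v::finite \<times> 'v) \<Rightarrow> (real^'d)^'v \<Rightarrow>
   real^('v \<times> 'd::finite)^('v \<times> 'd)" where
  "bearing_laplacian e p = transpose (rigidity_matrix e p) ** rigidity_matrix e p"

definition infinitesimally_bearing_rigid ::
  "('m::finite \<Rightarrow> 'v \<times> 'v) \<Rightarrow> (real^'d)^'v \<Rightarrow> bool" where
  "infinitesimally_bearing_rigid e p \<longleftrightarrow>
     rank (rigidity_matrix e p) = CARD('d) * CARD('v) - CARD('d) - 1"

definition follower_block ::
  "real^(('l::finite + 'f::finite) \<times> 'd::finite)^(('l + 'f) \<times> 'd) \<Rightarrow>
   real^('f \<times> 'd)^('f \<times> 'd)" where
  "follower_block L = (\<chi> a b. L $ (Inr (fst a), snd a) $ (Inr (fst b), snd b))"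

section \<open>Filippov solutions\<close>

definition absolutely_continuous_on :: "real set \<Rightarrow> (real \<Rightarrow> 'a::real_normed_vector) \<Rightarrow> bool" where
  "absolutely_continuous_on I f \<longleftrightarrow>
     (\<forall>\<epsilon>>0. \<exists>\<delta>>0. \<forall>D. D division_of \<Union>D \<and> \<Union>D \<subseteq> I \<and> (\<Sum>J\<in>D. Sup J - Inf J) < \<delta> \<longrightarrow>
        (\<Sum>J\<in>D. norm (f (Sup J) - f (Inf J))) < \<epsilon>)"

definition filippov_map ::
  "(real \<Rightarrow> 'a \<Rightarrow> 'a) \<Rightarrow> real \<Rightarrow> 'a \<Rightarrow> 'a::euclidean_space set" where
  "filippov_map F t x =
     (\<Inter>\<epsilon>\<in>{0<..}. \<Inter>S\<in>null_sets lebesgue. closure (convex hull (F t ` (ball x \<epsilon> - S))))"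

definition filippov_solution ::
  "(real \<Rightarrow> 'a \<Rightarrow> 'a) \<Rightarrow> (real \<Rightarrow> 'a::euclidean_space) \<Rightarrow> bool" where
  "filippov_solution F x \<longleftrightarrow>
     (\<forall>a b. 0 \<le> a \<and> a \<le> b \<longrightarrow> absolutely_continuous_on {a..b} x) \<and>
     (AE t in lebesgue. 0 \<le> t \<longrightarrow>
        (\<exists>v. (x has_vector_derivative v) (at t within {0..}) \<and> v \<in> filippov_map F t (x t)))"

section \<open>The closed-loop system\<close>

text \<open>The first component of a state holds the follower positions, the second the adaptive gains.
  The exponents \<open>0, \<dots>, N\<close> are indexed by a type \<open>'r\<close> with \<open>N + 1\<close> elements: \<open>\<rho>\<close> is a bijection from
  \<open>'r\<close> onto \<open>{0..N}\<close>.\<close>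

type_synonym ('d, 'f, 'm, 'r) state = "((real, 'd) vec, 'f) vec \<times> ((real, 'm) vec, 'r) vec"

definition positions ::
  "(real^'d)^('l::finite + 'f::finite) \<Rightarrow> ('d::finite, 'f, 'm::finite, 'r::finite) state \<Rightarrow>
   (real^'d)^('l + 'f)" where
  "positions pstar x = (\<chi> i. case i of Inl a \<Rightarrow> pstar $ Inl a | Inr b \<Rightarrow> fst x $ b)"

definition beta_hat ::
  "('r::finite \<Rightarrow> nat) \<Rightarrow> ('d::finite, 'f::finite, 'm::finite, 'r) state \<Rightarrow> nat \<Rightarrow> real^'m" where
  "beta_hat \<rho> x r = snd x $ inv \<rho> r"

definition q_vec :: "(real^'d)^'v \<Rightarrow> (real^'d)^'v \<Rightarrow> 'v \<Rightarrow> 'v \<Rightarrow> real^'d" where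
  "q_vec pstar p i j = projector (bearing pstar i j) *v (p $ i - p $ j)"

definition gain ::
  "nat \<Rightarrow> ('r::finite \<Rightarrow> nat) \<Rightarrow> ('m::finite \<Rightarrow> ('l::finite + 'f::finite) \<times> ('l + 'f)) \<Rightarrow>
   (real^'d)^('l + 'f) \<Rightarrow> ('d, 'f, 'm, 'r) state \<Rightarrow> 'l + 'f \<Rightarrow> 'l + 'f \<Rightarrow> real" where
  "gain N \<rho> e pstar x i j =
     (\<Sum>r=0..N. beta_hat \<rho> x r $ edge_index e i j
        * l1norm (q_vec pstar (positions pstar x) i j) ^ r)"

definition control ::
  "nat \<Rightarrow> ('r::finite \<Rightarrow> nat) \<Rightarrow> ('l::finite + 'f::finite) set set \<Rightarrow>
   ('m::finite \<Rightarrow> ('l + 'f) \<times> ('l + 'f)) \<Rightarrow>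
   (real^'d)^('l + 'f) \<Rightarrow> ('d, 'f, 'm, 'r) state \<Rightarrow> 'l + 'f \<Rightarrow> real^'d" where
  "control N \<rho> E e pstar x i =
     - (\<Sum>j\<in>nbrs E i. gain N \<rho> e pstar x i j *\<^sub>R
          (projector (bearing pstar i j) *v sgn_vec (q_vec pstar (positions pstar x) i j)))"

definition closed_loop ::
  "nat \<Rightarrow> ('r::finite \<Rightarrow> nat) \<Rightarrow> ('l::finite + 'f::finite) set set \<Rightarrow>
   ('m::finite \<Rightarrow> ('l + 'f) \<times> ('l + 'f)) \<Rightarrow>
   (real^'d)^('l + 'f) \<Rightarrow> (real \<Rightarrow> (real^'d)^('l + 'f)) \<Rightarrow>
   real \<Rightarrow> ('d, 'f, 'm, 'r) state \<Rightarrow> ('d, 'f, 'm, 'r) state" where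
  "closed_loop N \<rho> E e pstar dstb t x =
     (\<chi> i. control N \<rho> E e pstar x (Inr i) + dstb t $ Inr i,
      \<chi> s k. l1norm (q_vec pstar (positions pstar x) (fst (e k)) (snd (e k))) ^ (\<rho> s + 1))"

end

theory Submission
  imports Defs
begin

text \<open>
  Along a Filippov solution the product of \<open>\<delta>\<close> with the velocity is single-valued, since \<open>sgn q\<close> enters it
  only through \<open>q \<bullet> sgn q\<close>, the 1-norm of \<open>q\<close>. Infinitesimal bearing rigidity makes the follower block
  positive definite, which bounds the 1-norm of \<open>\<delta>\<close> by \<open>c = sqrt (d n / \<lambda>)\<close> times \<open>\<Sum>\<^sub>k |q\<^sub>k|\<^sub>1\<close>.
  With large reference gains, \<open>|\<delta>|\<^sup>2 + \<Sum> (\<beta>hat - \<beta>ref)\<^sup>2\<close> is nonincreasing; so everything is bounded,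
  the monotone gains converge, and \<open>\<delta>\<close> tends to \<open>0\<close>. Once \<open>\<delta>\<close> is small only the terms with \<open>r = 0\<close> matter:
  if the gains of order \<open>0\<close> exceed \<open>\<beta>\<^sub>0 c\<close>, then \<open>|\<delta>|\<close> decreases at a positive rate until it vanishes.
\<close>

subsection \<open>Absolutely continuous functions\<close>

text \<open>Since \<open>sgn\<close> jumps and solutions are differentiable only almost everywhere,
  the velocity is not a function of state and time. Every function differentiated along a solution
  is therefore chosen so that its differential involves only the product with
  \<open>\<delta>\<close> and the rates of the gains: squared distances, the norm away from the
  target, and linear functions of the gains. The degrees are matched by Hoelder's inequality: a
  disturbance of size \<open>\<beta>\<^sub>r |\<delta>|\<^sub>1^r\<close> does work at most
  \<open>\<beta>\<^sub>r |\<delta>|\<^sub>1^(r + 1)\<close>, and \<open>r + 1\<close> is the degree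
  at which the gains of order \<open>r\<close> grow. This is why the adaptive gains cancel in the
  derivative of the Lyapunov function, leaving only reference gains to be compared with the
  disturbance. In \<open>c\<close>, the factor \<open>sqrt (d n)\<close> is the price of passing
  from the 2-norm to the 1-norm, and \<open>1 / sqrt \<lambda>\<close> comes from the quadratic form
  of the follower block.\<close>

lemma absolutely_continuous_onE:
  assumes "absolutely_continuous_on I f" "\<epsilon> > 0"
  obtains \<delta> where "\<delta> > 0" "\<And>D. D division_of \<Union>D \<Longrightarrow> \<Union>D \<subseteq> I \<Longrightarrow>
      (\<Sum>J\<in>D. Sup J - Inf J) < \<delta> \<Longrightarrow> (\<Sum>J\<in>D. norm (f (Sup J) - f (Inf J))) < \<epsilon>"
  using assms unfolding absolutely_continuous_on_def by auto

lemma absolutely_continuous_on_lipschitz_compose: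
  fixes f :: "real \<Rightarrow> 'a::real_normed_vector" and g :: "'a \<Rightarrow> 'b::real_normed_vector"
  assumes f: "absolutely_continuous_on I f" and g: "C-lipschitz_on (f ` I) g"
  shows "absolutely_continuous_on I (\<lambda>t. g (f t))"
  unfolding absolutely_continuous_on_def
proof (intro allI impI)
  fix \<epsilon> :: real assume "\<epsilon> > 0"
  have C: "C \<ge> 0" using g by (rule lipschitz_on_nonneg)
  \<comment> \<open>\<open>C + 1\<close> instead of \<open>C\<close> avoids division by zero, since
    a constant \<open>g\<close> allows \<open>C = 0\<close>.\<close>
  have "\<epsilon> / (C + 1) > 0" using \<open>\<epsilon> > 0\<close> C by simp
  then obtain \<delta> where "\<delta> > 0" and \<delta>: "\<And>D. D division_of \<Union>D \<Longrightarrow> \<Union>D \<subseteq> I \<Longrightarrow>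
      (\<Sum>J\<in>D. Sup J - Inf J) < \<delta> \<Longrightarrow> (\<Sum>J\<in>D. norm (f (Sup J) - f (Inf J))) < \<epsilon> / (C + 1)"
    by (rule absolutely_continuous_onE[OF f]) blast
  show "\<exists>\<delta>>0. \<forall>D. D division_of \<Union>D \<and> \<Union>D \<subseteq> I \<and> (\<Sum>J\<in>D. Sup J - Inf J) < \<delta> \<longrightarrow>
        (\<Sum>J\<in>D. norm (g (f (Sup J)) - g (f (Inf J)))) < \<epsilon>"
  proof (intro exI conjI allI impI)
    fix D assume D: "D division_of \<Union>D \<and> \<Union>D \<subseteq> I \<and> (\<Sum>J\<in>D. Sup J - Inf J) < \<delta>"
    have mem: "Sup J \<in> I \<and> Inf J \<in> I" if "J \<in> D" for J
    proof -
      obtain u v where J: "J = cbox u v" "J \<noteq> {}"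
        using D \<open>J \<in> D\<close> by (metis division_ofD(3) division_ofD(4))
      then have "u \<le> v" by simp
      then have "Sup J \<in> J" "Inf J \<in> J" using J by auto
      then show ?thesis using D that by blast
    qed
    have "(\<Sum>J\<in>D. norm (g (f (Sup J)) - g (f (Inf J)))) \<le> (\<Sum>J\<in>D. (C + 1) * norm (f (Sup J) - f (Inf J)))"
    proof (rule sum_mono)
      fix J assume "J \<in> D"
      then have "norm (g (f (Sup J)) - g (f (Inf J))) \<le> C * norm (f (Sup J) - f (Inf J))"
        using mem lipschitz_on_normD[OF g] by blast
      also have "\<dots> \<le> (C + 1) * norm (f (Sup J) - f (Inf J))"
        by (simp add: distrib_right)
      finally show "norm (g (f (Sup J)) - g (f (Inf J))) \<le> (C + 1) * norm (f (Sup J) - f (Inf J))" .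
    qed
    also have "\<dots> = (C + 1) * (\<Sum>J\<in>D. norm (f (Sup J) - f (Inf J)))"
      by (simp add: sum_distrib_left)
    also have "\<dots> < (C + 1) * (\<epsilon> / (C + 1))"
      using \<delta>[of D] D C by (intro mult_strict_left_mono) auto
    finally show "(\<Sum>J\<in>D. norm (g (f (Sup J)) - g (f (Inf J)))) < \<epsilon>" using C by simp
  qed fact
qed

lemma absolutely_continuous_on_imp_continuous_on:
  fixes f :: "real \<Rightarrow> 'a::real_normed_vector"
  assumes f: "absolutely_continuous_on {a..b} f"
  shows "continuous_on {a..b} f"
  unfolding continuous_on_iff
proof (intro ballI allI impI)
  fix s \<epsilon> :: real assume s: "s \<in> {a..b}" and "\<epsilon> > 0"
  obtain \<delta> where "\<delta> > 0" and \<delta>: "\<And>D. D division_of \<Union>D \<Longrightarrow> \<Union>D \<subseteq> {a..b} \<Longrightarrow>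
      (\<Sum>J\<in>D. Sup J - Inf J) < \<delta> \<Longrightarrow> (\<Sum>J\<in>D. norm (f (Sup J) - f (Inf J))) < \<epsilon>"
    by (rule absolutely_continuous_onE[OF f \<open>\<epsilon> > 0\<close>]) blast
  \<comment> \<open>A division with one element turns the condition on sums into a modulus of
    continuity.\<close>
  have close: "norm (f v - f u) < \<epsilon>" if "u \<le> v" "u \<in> {a..b}" "v \<in> {a..b}" "v - u < \<delta>" for u v
    using \<delta>[of "{{u..v}}"] that division_of_self[of u v] by (simp add: cbox_interval)
  show "\<exists>d>0. \<forall>s'\<in>{a..b}. dist s' s < d \<longrightarrow> dist (f s') (f s) < \<epsilon>"
  proof (intro exI conjI ballI impI)
    fix s' assume "s' \<in> {a..b}" "dist s' s < \<delta>"
    then show "dist (f s') (f s) < \<epsilon>"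
      using close[of s s'] close[of s' s] s
      by (cases "s \<le> s'") (auto simp: dist_norm norm_minus_commute)
  qed fact
qed

text \<open>Two boxes of a division meet in a convex set with empty interior, which is null, so the
  measure is additive over the division. This bounds the total length of the intervals tagged in the
  null set by the measure of an open cover.\<close>

lemma sum_content_le_measure:
  fixes D :: "'a::euclidean_space set set"
  assumes D: "D division_of \<Union>D" and sub: "\<Union>D \<subseteq> G" and G: "G \<in> lmeasurable"
  shows "(\<Sum>K\<in>D. measure lebesgue K) \<le> measure lebesgue G"
proof -
  have box: "\<exists>u v. K = cbox u v" if "K \<in> D" for K
    using division_ofD(4)[OF D that] .
  have "measure lebesgue (\<Union>D) = (\<Sum>K\<in>D. measure lebesgue K)"
  proof (rule measure_negligible_finite_Union)
    show "finite D" using D by blast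
    show "K \<in> lmeasurable" if "K \<in> D" for K using box[OF that] by auto
    show "pairwise (\<lambda>K L. negligible (K \<inter> L)) D"
    proof (rule pairwiseI)
      fix K L assume *: "K \<in> D" "L \<in> D" "K \<noteq> L"
      then have "interior (K \<inter> L) = {}" using division_ofD(5)[OF D] by simp
      moreover have "convex (K \<inter> L)" using box[OF *(1)] box[OF *(2)] by (auto intro: convex_Int)
      ultimately show "negligible (K \<inter> L)" by (simp add: negligible_convex_interior)
    qed
  qed
  moreover have "\<Union>D \<in> lmeasurable" using D by (rule lmeasurable_division)
  ultimately show ?thesis using measure_mono_fmeasurable[OF sub fmeasurableD G] by simp
qed

lemma null_set_outer_open:
  assumes "Z \<in> null_sets (lebesgue :: 'a::euclidean_space measure)" "e > 0"
  obtains G where "open G" "Z \<subseteq> G" "G \<in> lmeasurable" "measure lebesgue G < e"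
proof -
  obtain G where G: "open G" "Z \<subseteq> G" "G - Z \<in> lmeasurable" "emeasure lebesgue (G - Z) < ennreal e"
    using sets_lebesgue_outer_open[of Z e] assms by blast
  have Z: "Z \<in> lmeasurable" using assms(1) by (simp add: negligible_iff_null_sets[symmetric] negligible_imp_measurable)
  have eq: "G = (G - Z) \<union> Z" using G by blast
  then have lG: "G \<in> lmeasurable" using G(3) Z by (metis fmeasurable.Un)
  have "emeasure lebesgue G = emeasure lebesgue (G - Z)"
    using emeasure_Diff_null_set[OF assms(1), of G] lG by simp
  then have "measure lebesgue G < e"
    using G(4) lG assms(2) by (metis emeasure_eq_measure2 ennreal_less_iff measure_nonneg)
  then show ?thesis using G lG that by blast
qed

text \<open>The fundamental theorem of calculus in the only form needed, by a Cousin partition: tags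
  outside the null set give increments at most \<open>\<epsilon>\<close> times the length, and the intervals with tags in
  the null set have small total length, so that absolute continuity controls their increments.\<close>

lemma absolutely_continuous_nonincreasing:
  fixes f :: "real \<Rightarrow> real"
  assumes ac: "absolutely_continuous_on {a..b} f" and "a \<le> b"
    and deriv: "AE t in lebesgue. t \<in> {a..b} \<longrightarrow>
      (\<exists>v\<le>0. (f has_real_derivative v) (at t within {a..b}))"
  shows "f b \<le> f a"
proof -
  define P where "P t \<longleftrightarrow> (\<exists>v\<le>0. (f has_real_derivative v) (at t within {a..b}))" for t
  have "AE t in lebesgue. t \<in> {a..b} \<longrightarrow> P t" using deriv by (simp add: P_def)
  then obtain Z where Z: "Z \<in> null_sets lebesgue"
    and ZP: "{t \<in> space lebesgue. \<not> (t \<in> {a..b} \<longrightarrow> P t)} \<subseteq> Z"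
    unfolding eventually_ae_filter by blast
  have Zd: "\<exists>v\<le>0. (f has_real_derivative v) (at t within {a..b})" if "t \<notin> Z" "t \<in> {a..b}" for t
    using ZP that unfolding P_def[symmetric] by auto
  \<comment> \<open>The \<open>1\<close> pays for the intervals tagged in the null set, the
    \<open>b - a\<close> for all others.\<close>
  have main: "f b - f a \<le> \<epsilon> * (1 + (b - a))" if "\<epsilon> > 0" for \<epsilon>
  proof -
    obtain \<delta> where "\<delta> > 0" and \<delta>: "\<And>D. D division_of \<Union>D \<Longrightarrow> \<Union>D \<subseteq> {a..b} \<Longrightarrow>
      (\<Sum>J\<in>D. Sup J - Inf J) < \<delta> \<Longrightarrow> (\<Sum>J\<in>D. norm (f (Sup J) - f (Inf J))) < \<epsilon>"
      by (rule absolutely_continuous_onE[OF ac \<open>\<epsilon> > 0\<close>]) blast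
    obtain G where G: "open G" "Z \<subseteq> G" "G \<in> lmeasurable" "measure lebesgue G < \<delta>"
      using null_set_outer_open[OF Z \<open>\<delta> > 0\<close>] .
    \<comment> \<open>The tag lies inside its interval, so the increment is split there; the two
      one-sided estimates add up to one for the whole interval.\<close>
    have slope: "\<exists>d>0. \<forall>y\<in>{a..b}. \<bar>y - t\<bar> < d \<longrightarrow>
        (y \<ge> t \<longrightarrow> f y - f t \<le> \<epsilon> * (y - t)) \<and> (y \<le> t \<longrightarrow> f t - f y \<le> \<epsilon> * (t - y))"
      if t: "t \<notin> Z" "t \<in> {a..b}" for t
    proof -
      obtain v where v: "v \<le> 0" "(f has_real_derivative v) (at t within {a..b})"
        using Zd[OF t] by blast
      then obtain d where "d > 0" and d: "\<And>y. y \<in> {a..b} \<Longrightarrow> norm (y - t) < d \<Longrightarrow>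
          norm (f y - f t - v * (y - t)) \<le> \<epsilon> * norm (y - t)"
        using \<open>\<epsilon> > 0\<close> unfolding has_field_derivative_def has_derivative_within_alt by metis
      show ?thesis
      proof (intro exI conjI ballI impI)
        fix y assume y: "y \<in> {a..b}" "\<bar>y - t\<bar> < d"
        have *: "\<bar>f y - f t - v * (y - t)\<bar> \<le> \<epsilon> * \<bar>y - t\<bar>" using d y by simp
        show "f y - f t \<le> \<epsilon> * (y - t)" if "y \<ge> t"
          using * that mult_nonpos_nonneg[OF v(1), of "y - t"] by simp
        show "f t - f y \<le> \<epsilon> * (t - y)" if "y \<le> t"
          using * that mult_nonpos_nonpos[OF v(1), of "y - t"] by simp
      qed fact
    qed
    \<comment> \<open>One gauge serves both kinds of tags: it confines intervals tagged in
      \<open>Z\<close> to the small open set \<open>G\<close> and enforces the slope estimate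
      elsewhere.\<close>
    have "\<exists>d. d > 0 \<and> (t \<in> Z \<longrightarrow> ball t d \<subseteq> G) \<and>
      (t \<notin> Z \<longrightarrow> t \<in> {a..b} \<longrightarrow> (\<forall>y\<in>{a..b}. \<bar>y - t\<bar> < d \<longrightarrow>
        (y \<ge> t \<longrightarrow> f y - f t \<le> \<epsilon> * (y - t)) \<and> (y \<le> t \<longrightarrow> f t - f y \<le> \<epsilon> * (t - y))))" for t
    proof (cases "t \<in> Z")
      case True
      then obtain d where "d > 0" "ball t d \<subseteq> G" using G(1,2) openE by blast
      then show ?thesis using True by blast
    next
      case False
      show ?thesis
      proof (cases "t \<in> {a..b}")
        case True
        show ?thesis using slope[OF False True] False by blast
      next
        case nt: False
        show ?thesis using False nt by (metis zero_less_one)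
      qed
    qed
    then obtain r where r: "\<And>t. r t > 0 \<and> (t \<in> Z \<longrightarrow> ball t (r t) \<subseteq> G) \<and>
      (t \<notin> Z \<longrightarrow> t \<in> {a..b} \<longrightarrow> (\<forall>y\<in>{a..b}. \<bar>y - t\<bar> < r t \<longrightarrow>
        (y \<ge> t \<longrightarrow> f y - f t \<le> \<epsilon> * (y - t)) \<and> (y \<le> t \<longrightarrow> f t - f y \<le> \<epsilon> * (t - y))))"
      by (rule that[OF someI_ex])
    have "gauge (\<lambda>t. ball t (r t))" using r by (simp add: gauge_def)
    then obtain p where p: "p tagged_division_of {a..b}" "(\<lambda>t. ball t (r t)) fine p"
      using fine_division_exists_real by blast
    define q where "q = {(t, K) \<in> p. t \<in> Z}"
    have qp: "q \<subseteq> p" by (auto simp: q_def)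
    have finp: "finite p" using p by blast
    have int: "\<exists>u v. K = {u..v} \<and> u \<le> t \<and> t \<le> v \<and> {u..v} \<subseteq> {a..b} \<and> {u..v} \<subseteq> ball t (r t)"
      if tK: "(t, K) \<in> p" for t K
    proof -
      obtain u v where "K = cbox u v" using tagged_division_ofD(4)[OF p(1) tK] by blast
      moreover have "t \<in> K" "K \<subseteq> {a..b}" using tagged_division_ofD(2,3)[OF p(1) tK] by auto
      moreover have "K \<subseteq> ball t (r t)" using p(2) tK unfolding fine_def by blast
      ultimately show ?thesis by (auto simp: cbox_interval)
    qed
    have good: "f (Sup K) - f (Inf K) \<le> \<epsilon> * measure lborel K" if tK: "(t, K) \<in> p" "t \<notin> Z" for t K
    proof -
      obtain u v where K: "K = {u..v}" "u \<le> t" "t \<le> v" "{u..v} \<subseteq> {a..b}" "{u..v} \<subseteq> ball t (r t)"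
        using int[OF tK(1)] by blast
      have uv: "u \<in> {u..v}" "v \<in> {u..v}" using K by auto
      have "t \<in> {a..b}" "u \<in> {a..b}" "v \<in> {a..b}" using K(2-4) by (auto simp: subset_iff)
      moreover have "\<bar>u - t\<bar> < r t" "\<bar>v - t\<bar> < r t"
        using uv K(5) by (auto simp: subset_iff dist_real_def abs_minus_commute)
      ultimately have "f v - f t \<le> \<epsilon> * (v - t)" "f t - f u \<le> \<epsilon> * (t - u)"
        using r[of t] tK(2) K(2,3) by simp_all
      then have "f v - f u \<le> \<epsilon> * (v - u)" by (simp add: algebra_simps)
      then show ?thesis using K by simp
    qed
    have q_tag: "q tagged_division_of \<Union>(snd ` q)"
      using p(1) qp tagged_partial_division_of_Union_self tagged_partial_division_subset
        tagged_division_of_def by metis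
    then have D: "snd ` q division_of \<Union>(snd ` q)" by (rule division_of_tagged_division)
    have Dsub: "\<Union>(snd ` q) \<subseteq> {a..b}" using int qp by fastforce
    have DG: "\<Union>(snd ` q) \<subseteq> G" 
    proof clarsimp
      fix s t K assume "(t, K) \<in> q" "s \<in> K"
      then show "s \<in> G" using int[of t K] r[of t] unfolding q_def by auto
    qed
    have "(\<Sum>J\<in>snd ` q. Sup J - Inf J) = (\<Sum>J\<in>snd ` q. measure lebesgue J)"
    proof (rule sum.cong)
      fix J assume "J \<in> snd ` q"
      then obtain t where "(t, J) \<in> p" using qp by auto
      then show "Sup J - Inf J = measure lebesgue J" using int[of t J] by auto
    qed simp
    also have "\<dots> < \<delta>" using sum_content_le_measure[OF D DG G(3)] G(4) by simp
    finally have "(\<Sum>J\<in>snd ` q. norm (f (Sup J) - f (Inf J))) < \<epsilon>" using \<delta>[OF D Dsub] by simp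
    moreover have "(\<Sum>(t, K)\<in>q. norm (f (Sup K) - f (Inf K))) = (\<Sum>J\<in>snd ` q. norm (f (Sup J) - f (Inf J)))"
    proof -
      \<comment> \<open>Passing from tagged pairs to bare intervals is legitimate because an
        interval with two tags is degenerate and has increment \<open>0\<close>. The value at
        \<open>{}\<close> is set by hand, as \<open>Sup {}\<close> and \<open>Inf {}\<close> need
        not agree.\<close>
      define d where "d K = (if K = {} then 0 else norm (f (Sup K) - f (Inf K)))" for K
      have ne: "K \<noteq> {}" if "(t, K) \<in> q" for t K using tagged_division_ofD(2)[OF p(1), of t K] that qp by blast
      have "(\<Sum>(t, K)\<in>q. d K) = (\<Sum>J\<in>snd ` q. d J)"
      proof (rule sum.over_tagged_division_lemma[OF q_tag])
        fix u v :: real assume "box u v = {}"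
        then have "v \<le> u" by simp
        then show "d (cbox u v) = 0"
          by (cases "u = v") (auto simp: cbox_interval d_def)
      qed
      moreover have "(\<Sum>(t, K)\<in>q. d K) = (\<Sum>(t, K)\<in>q. norm (f (Sup K) - f (Inf K)))"
        using ne by (intro sum.cong) (auto simp: d_def)
      moreover have "(\<Sum>J\<in>snd ` q. d J) = (\<Sum>J\<in>snd ` q. norm (f (Sup J) - f (Inf J)))"
        using ne by (intro sum.cong) (auto simp: d_def)
      ultimately show ?thesis by simp
    qed
    ultimately have bad: "(\<Sum>(t, K)\<in>q. norm (f (Sup K) - f (Inf K))) < \<epsilon>" by simp
    have "f b - f a = (\<Sum>(t, K)\<in>p. f (Sup K) - f (Inf K))"
      using additive_tagged_division_1[OF \<open>a \<le> b\<close> p(1)] by metis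
    also have "\<dots> = (\<Sum>(t, K)\<in>p - q. f (Sup K) - f (Inf K)) + (\<Sum>(t, K)\<in>q. f (Sup K) - f (Inf K))"
      using sum.subset_diff[OF qp finp] .
    also have "(\<Sum>(t, K)\<in>p - q. f (Sup K) - f (Inf K)) \<le> (\<Sum>(t, K)\<in>p - q. \<epsilon> * measure lborel K)"
      using good by (intro sum_mono) (auto simp: q_def)
    also have "\<dots> \<le> (\<Sum>(t, K)\<in>p. \<epsilon> * measure lborel K)"
      using \<open>\<epsilon> > 0\<close> finp by (intro sum_mono2) auto
    also have "\<dots> = \<epsilon> * (\<Sum>(t, K)\<in>p. measure lborel K)"
      by (simp add: sum_distrib_left case_prod_unfold)
    also have "(\<Sum>(t, K)\<in>p. measure lborel K) = b - a"
      using additive_content_tagged_division[of p a b] p(1) \<open>a \<le> b\<close> by (simp add: cbox_interval)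
    also have "(\<Sum>(t, K)\<in>q. f (Sup K) - f (Inf K)) \<le> (\<Sum>(t, K)\<in>q. norm (f (Sup K) - f (Inf K)))"
      by (intro sum_mono) auto
    finally show ?thesis using bad by (simp add: algebra_simps)
  qed
  show ?thesis
  proof (rule field_le_epsilon)
    fix e :: real assume "e > 0"
    then show "f b \<le> f a + e" using main[of "e / (1 + (b - a))"] \<open>a \<le> b\<close> by simp
  qed
qed

lemma absolutely_continuous_on_add:
  fixes f g :: "real \<Rightarrow> 'a::real_normed_vector"
  assumes f: "absolutely_continuous_on I f" and g: "absolutely_continuous_on I g"
  shows "absolutely_continuous_on I (\<lambda>t. f t + g t)"
  unfolding absolutely_continuous_on_def
proof (intro allI impI)
  fix \<epsilon> :: real assume "\<epsilon> > 0"
  then have e2: "\<epsilon> / 2 > 0" by simp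
  obtain \<delta>1 where "\<delta>1 > 0" and \<delta>1: "\<And>D. D division_of \<Union>D \<Longrightarrow> \<Union>D \<subseteq> I \<Longrightarrow>
      (\<Sum>J\<in>D. Sup J - Inf J) < \<delta>1 \<Longrightarrow> (\<Sum>J\<in>D. norm (f (Sup J) - f (Inf J))) < \<epsilon> / 2"
    by (rule absolutely_continuous_onE[OF f e2]) blast
  obtain \<delta>2 where "\<delta>2 > 0" and \<delta>2: "\<And>D. D division_of \<Union>D \<Longrightarrow> \<Union>D \<subseteq> I \<Longrightarrow>
      (\<Sum>J\<in>D. Sup J - Inf J) < \<delta>2 \<Longrightarrow> (\<Sum>J\<in>D. norm (g (Sup J) - g (Inf J))) < \<epsilon> / 2"
    by (rule absolutely_continuous_onE[OF g e2]) blast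
  show "\<exists>\<delta>>0. \<forall>D. D division_of \<Union>D \<and> \<Union>D \<subseteq> I \<and> (\<Sum>J\<in>D. Sup J - Inf J) < \<delta> \<longrightarrow>
        (\<Sum>J\<in>D. norm (f (Sup J) + g (Sup J) - (f (Inf J) + g (Inf J)))) < \<epsilon>"
  proof (intro exI conjI allI impI)
    show "min \<delta>1 \<delta>2 > 0" using \<open>\<delta>1 > 0\<close> \<open>\<delta>2 > 0\<close> by simp
    fix D assume D: "D division_of \<Union>D \<and> \<Union>D \<subseteq> I \<and> (\<Sum>J\<in>D. Sup J - Inf J) < min \<delta>1 \<delta>2"
    have "(\<Sum>J\<in>D. norm (f (Sup J) + g (Sup J) - (f (Inf J) + g (Inf J))))
        \<le> (\<Sum>J\<in>D. norm (f (Sup J) - f (Inf J)) + norm (g (Sup J) - g (Inf J)))"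
      by (intro sum_mono norm_diff_triangle_ineq)
    also have "\<dots> < \<epsilon> / 2 + \<epsilon> / 2"
      unfolding sum.distrib using D \<delta>1[of D] \<delta>2[of D] by (intro add_strict_mono) auto
    finally show "(\<Sum>J\<in>D. norm (f (Sup J) + g (Sup J) - (f (Inf J) + g (Inf J)))) < \<epsilon>" by simp
  qed
qed

lemma absolutely_continuous_on_linear: "absolutely_continuous_on I (\<lambda>t. c * t :: real)"
proof -
  have "absolutely_continuous_on I (\<lambda>t. t)"
    unfolding absolutely_continuous_on_def
  proof (intro allI impI)
    fix \<epsilon> :: real assume "\<epsilon> > 0"
    have eq: "(\<Sum>J\<in>D. norm (Sup J - Inf J)) = (\<Sum>J\<in>D. Sup J - Inf J)"
      if D: "D division_of \<Union>D" for D :: "real set set"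
    proof (rule sum.cong)
      fix J assume "J \<in> D"
      then obtain u v where "J = cbox u v" "J \<noteq> {}"
        using division_ofD(3,4)[OF D] by metis
      then show "norm (Sup J - Inf J) = Sup J - Inf J" by (simp add: cbox_interval)
    qed simp
    show "\<exists>\<delta>>0. \<forall>D. D division_of \<Union>D \<and> \<Union>D \<subseteq> I \<and> (\<Sum>J\<in>D. Sup J - Inf J) < \<delta> \<longrightarrow>
        (\<Sum>J\<in>D. norm (Sup J - Inf J)) < \<epsilon>"
    proof (intro exI conjI allI impI)
      fix D assume "D division_of \<Union>D \<and> \<Union>D \<subseteq> I \<and> (\<Sum>J\<in>D. Sup J - Inf J) < \<epsilon>"
      then show "(\<Sum>J\<in>D. norm (Sup J - Inf J)) < \<epsilon>" using eq[of D] by linarith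
    qed fact
  qed
  from absolutely_continuous_on_lipschitz_compose[OF this lipschitz_on_cmult_real[OF lipschitz_on_id]]
  show ?thesis .
qed

text \<open>Subtracting the line \<open>c * t\<close> reduces the claim to
  \<open>absolutely_continuous_nonincreasing\<close>. Differentiability of \<open>\<Phi>\<close>
  gives the chain rule at almost every time, while the Lipschitz condition on the arc is what
  preserves absolute continuity under composition.\<close>

lemma growth_along_absolutely_continuous:
  fixes x :: "real \<Rightarrow> 'a::real_normed_vector" and \<Phi> :: "'a \<Rightarrow> real"
  assumes ac: "absolutely_continuous_on {a..b} x" and "a \<le> b"
    and lip: "C-lipschitz_on (x ` {a..b}) \<Phi>"
    and der: "\<And>t. t \<in> {a..b} \<Longrightarrow> (\<Phi> has_derivative \<Phi>' (x t)) (at (x t))"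
    and ae: "AE t in lebesgue. t \<in> {a..b} \<longrightarrow>
      (\<exists>v. (x has_vector_derivative v) (at t within {a..b}) \<and> \<Phi>' (x t) v \<le> c)"
  shows "\<Phi> (x b) \<le> \<Phi> (x a) + c * (b - a)"
proof -
  have "absolutely_continuous_on {a..b} (\<lambda>t. \<Phi> (x t) + (- c) * t)"
    by (intro absolutely_continuous_on_add absolutely_continuous_on_linear
        absolutely_continuous_on_lipschitz_compose[OF ac lip])
  moreover have "AE t in lebesgue. t \<in> {a..b} \<longrightarrow>
      (\<exists>v\<le>0. ((\<lambda>t. \<Phi> (x t) + (- c) * t) has_real_derivative v) (at t within {a..b}))"
    using ae
  proof (rule AE_mp, intro AE_I2 impI)
    fix t assume imp: "t \<in> {a..b} \<longrightarrow>
      (\<exists>v. (x has_vector_derivative v) (at t within {a..b}) \<and> \<Phi>' (x t) v \<le> c)" and t: "t \<in> {a..b}"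
    then obtain v where v: "(x has_vector_derivative v) (at t within {a..b})" "\<Phi>' (x t) v \<le> c"
      by blast
    have "((\<lambda>t. \<Phi> (x t)) has_vector_derivative \<Phi>' (x t) v) (at t within {a..b})"
      using vector_derivative_diff_chain_within[OF v(1) has_derivative_at_withinI[OF der[OF t]]]
      by (simp add: o_def)
    then have "((\<lambda>t. \<Phi> (x t)) has_real_derivative \<Phi>' (x t) v) (at t within {a..b})"
      by (simp add: has_real_derivative_iff_has_vector_derivative)
    then have "((\<lambda>t. \<Phi> (x t) + (- c) * t) has_real_derivative \<Phi>' (x t) v + (- c) * 1) (at t within {a..b})"
      by (intro DERIV_add DERIV_cmult DERIV_ident)
    then show "\<exists>v\<le>0. ((\<lambda>t. \<Phi> (x t) + (- c) * t) has_real_derivative v) (at t within {a..b})"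
      using v(2) by (intro exI[of _ "\<Phi>' (x t) v + (- c) * 1"]) simp
  qed
  ultimately have "\<Phi> (x b) + (- c) * b \<le> \<Phi> (x a) + (- c) * a"
    by (rule absolutely_continuous_nonincreasing[OF _ \<open>a \<le> b\<close>])
  then show ?thesis by (simp add: algebra_simps)
qed

text \<open>A difference of squares factors as \<open>(g y + g z) \<bullet> (g y - g z)\<close>,
  whose first factor is bounded. It makes the quadratic Lyapunov functions admissible along compact
  arcs.\<close>

lemma lipschitz_on_inner_self:
  fixes g :: "'a::metric_space \<Rightarrow> 'b::real_inner"
  assumes g: "1-lipschitz_on S g" and bdd: "bounded (g ` S)"
  shows "\<exists>C. C-lipschitz_on S (\<lambda>y. g y \<bullet> g y)"
proof -
  obtain M where "M > 0" and M: "\<And>y. y \<in> S \<Longrightarrow> norm (g y) \<le> M"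
    using bdd unfolding bounded_pos by auto
  have "(2 * M)-lipschitz_on S (\<lambda>y. g y \<bullet> g y)"
  proof (rule lipschitz_onI)
    fix y z assume yz: "y \<in> S" "z \<in> S"
    have "g y \<bullet> g y - g z \<bullet> g z = (g y + g z) \<bullet> (g y - g z)"
      by (simp add: inner_add_left inner_diff_right inner_commute[of "g z" "g y"])
    also have "\<bar>\<dots>\<bar> \<le> norm (g y + g z) * norm (g y - g z)" by (rule Cauchy_Schwarz_ineq2)
    also have "\<dots> \<le> (2 * M) * dist y z"
    proof (rule mult_mono)
      show "norm (g y + g z) \<le> 2 * M" using M[OF yz(1)] M[OF yz(2)] norm_triangle_ineq[of "g y" "g z"] by simp
      show "norm (g y - g z) \<le> dist y z" using lipschitz_onD[OF g yz] by (simp add: dist_norm)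
    qed (use \<open>M > 0\<close> in auto)
    finally show "dist (g y \<bullet> g y) (g z \<bullet> g z) \<le> 2 * M * dist y z" by (simp add: dist_real_def)
  qed (use \<open>M > 0\<close> in simp)
  then show ?thesis by blast
qed

subsection \<open>Velocities of Filippov solutions\<close>

text \<open>For states the right-hand side is discontinuous, but the velocity tested against a suitable
  continuous field is continuous; then all Filippov velocities give the same value.\<close>

lemma filippov_map_inner:
  fixes F :: "real \<Rightarrow> 'a \<Rightarrow> 'a::euclidean_space" and w :: "'a \<Rightarrow> 'a"
  assumes v: "v \<in> filippov_map F t x" and w: "isCont w x"
    and h: "isCont (\<lambda>y. w y \<bullet> F t y) x"
    and bdd: "r > 0" "bounded (F t ` ball x r)"
  shows "w x \<bullet> v = w x \<bullet> F t x"
proof -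
  obtain M where "M > 0" and M: "\<And>y. y \<in> ball x r \<Longrightarrow> norm (F t y) \<le> M"
    using bdd(2) unfolding bounded_pos by auto
  have "\<bar>w x \<bullet> v - w x \<bullet> F t x\<bar> \<le> \<eta>" if "\<eta> > 0" for \<eta>
  proof -
    have "\<eta> / (2 * M) > 0" using \<open>\<eta> > 0\<close> \<open>M > 0\<close> by simp
    then obtain d1 where d1: "d1 > 0" "\<And>y. dist y x < d1 \<Longrightarrow> dist (w y) (w x) < \<eta> / (2 * M)"
      using w unfolding continuous_at_eps_delta by metis
    have "\<eta> / 2 > 0" using \<open>\<eta> > 0\<close> by simp
    then obtain d2 where d2: "d2 > 0"
      "\<And>y. dist y x < d2 \<Longrightarrow> dist (w y \<bullet> F t y) (w x \<bullet> F t x) < \<eta> / 2"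
      using h unfolding continuous_at_eps_delta by metis
    define \<epsilon> where "\<epsilon> = min r (min d1 d2)"
    have \<epsilon>: "\<epsilon> > 0" using bdd(1) d1 d2 by (simp add: \<epsilon>_def)
    \<comment> \<open>A closed slab is convex, so it contains the closed convex hull as soon as it
      contains the values of \<open>F t\<close> near \<open>x\<close>.\<close>
    define C where "C = {u. w x \<bullet> u \<le> w x \<bullet> F t x + \<eta>} \<inter> {u. w x \<bullet> u \<ge> w x \<bullet> F t x - \<eta>}"
    have C: "closed C" "convex C" unfolding C_def
      by (auto intro!: closed_Int convex_Int closed_halfspace_le closed_halfspace_ge
          convex_halfspace_le convex_halfspace_ge)
    \<comment> \<open>One member of the intersection defining the Filippov map is enough; the
      exceptional set is taken to be empty.\<close>
    have "F t ` (ball x \<epsilon> - {}) \<subseteq> C"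
    proof clarsimp
      fix y assume y: "dist x y < \<epsilon>"
      then have y': "dist y x < d1" "dist y x < d2" "y \<in> ball x r"
        by (auto simp: \<epsilon>_def dist_commute)
      \<comment> \<open>Continuity is known for the product with \<open>w y\<close>, whereas the
        slab is cut out by the fixed vector \<open>w x\<close>. Local boundedness of
        \<open>F t\<close> makes the exchange cost at most \<open>\<eta> / 2\<close>.\<close>
      have "\<bar>(w x - w y) \<bullet> F t y\<bar> \<le> norm (w x - w y) * norm (F t y)"
        by (rule Cauchy_Schwarz_ineq2)
      also have "\<dots> \<le> (\<eta> / (2 * M)) * M"
        using d1(2)[OF y'(1)] M[OF y'(3)] \<open>M > 0\<close> \<open>\<eta> > 0\<close>
        by (intro mult_mono) (auto simp: dist_norm norm_minus_commute)
      finally have "\<bar>(w x - w y) \<bullet> F t y\<bar> \<le> \<eta> / 2" using \<open>M > 0\<close> by simp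
      then show "F t y \<in> C" using d2(2)[OF y'(2)]
        unfolding C_def dist_real_def inner_diff_left mem_Collect_eq Int_iff by linarith
    qed
    then have "closure (convex hull (F t ` (ball x \<epsilon> - {}))) \<subseteq> C"
      using C by (meson closure_minimal hull_minimal)
    moreover have "v \<in> closure (convex hull (F t ` (ball x \<epsilon> - {})))"
      using v \<epsilon> unfolding filippov_map_def by blast
    ultimately show ?thesis unfolding C_def by (auto simp: abs_le_iff)
  qed
  then have "\<bar>w x \<bullet> v - w x \<bullet> F t x\<bar> \<le> 0" by (rule field_le_epsilon) simp
  then show ?thesis by simp
qed

subsection \<open>The 1-norm\<close>

lemma l1norm_nonneg: "0 \<le> l1norm x"
  unfolding l1norm_def by (simp add: sum_nonneg)

lemma norm_le_l1norm: "norm x \<le> l1norm x"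
  unfolding l1norm_def by (rule norm_le_l1)

lemma continuous_l1norm [continuous_intros]:
  "continuous F f \<Longrightarrow> continuous F (\<lambda>y. l1norm (f y))"
  unfolding l1norm_def by (intro continuous_intros)

lemma l1norm_minus: "l1norm (- x) = l1norm x"
  by (simp add: l1norm_def)

lemma inner_le_infnorm_l1norm: "x \<bullet> y \<le> infnorm x * l1norm y"
proof -
  have "x \<bullet> y = (\<Sum>b\<in>Basis. (x \<bullet> b) * (y \<bullet> b))" by (rule euclidean_inner)
  also have "\<dots> \<le> (\<Sum>b\<in>Basis. infnorm x * \<bar>y \<bullet> b\<bar>)"
  proof (rule sum_mono)
    fix b :: 'a assume "b \<in> Basis"
    have "(x \<bullet> b) * (y \<bullet> b) \<le> \<bar>x \<bullet> b\<bar> * \<bar>y \<bullet> b\<bar>" by (metis abs_ge_self abs_mult)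
    also have "\<dots> \<le> infnorm x * \<bar>y \<bullet> b\<bar>"
      using Basis_le_infnorm[OF \<open>b \<in> Basis\<close>] by (intro mult_right_mono) auto
    finally show "(x \<bullet> b) * (y \<bullet> b) \<le> infnorm x * \<bar>y \<bullet> b\<bar>" .
  qed
  finally show ?thesis by (simp add: l1norm_def sum_distrib_left)
qed

text \<open>Cauchy-Schwarz against the vector of ones; applied to a stacked vector it yields the
  factor \<open>sqrt (d n)\<close> of the final constant.\<close>

lemma l1norm_le_norm: "l1norm (x :: 'a::euclidean_space) \<le> sqrt (real DIM('a)) * norm x"
proof -
  have "(l1norm x)\<^sup>2 \<le> (\<Sum>b\<in>Basis. \<bar>x \<bullet> b\<bar>\<^sup>2) * real DIM('a)"
    unfolding l1norm_def by (rule sum_squared_le_sum_of_squares)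
  also have "(\<Sum>b\<in>Basis. \<bar>x \<bullet> b\<bar>\<^sup>2) = (norm x)\<^sup>2"
    unfolding power2_norm_eq_inner by (subst euclidean_inner) (simp add: power2_eq_square)
  also have "(norm x)\<^sup>2 * real DIM('a) = (sqrt (real DIM('a)) * norm x)\<^sup>2"
    by (simp add: power_mult_distrib)
  finally show ?thesis by (rule power2_le_imp_le) simp
qed

lemma l1norm_vec: "l1norm (x :: real^'d) = (\<Sum>a\<in>UNIV. \<bar>x $ a\<bar>)"
proof -
  have B: "(Basis :: (real^'d) set) = range (\<lambda>a. axis a 1)"
    by (auto simp: Basis_vec_def)
  have inj: "inj (\<lambda>a. axis a 1 :: real^'d)" by (auto simp: inj_on_def axis_eq_axis)
  show ?thesis
    unfolding l1norm_def B sum.reindex[OF inj] by (simp add: inner_axis)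
qed

lemma sgn_vec_inner_self: "sgn_vec x \<bullet> x = l1norm x"
  unfolding sgn_vec_def l1norm_vec by (simp add: inner_vec_def abs_sgn mult.commute)

lemma sgn_vec_minus: "sgn_vec (- x) = - sgn_vec x"
  by (simp add: sgn_vec_def vec_eq_iff sgn_minus)

subsection \<open>The smallest eigenvalue of a symmetric matrix\<close>

lemma inner_mult_symmetric:
  fixes A :: "real^'n^'n"
  assumes "transpose A = A"
  shows "(A *v x) \<bullet> y = x \<bullet> (A *v y)"
  by (metis assms dot_lmul_matrix transpose_matrix_vector)

text \<open>Eigenvectors of distinct eigenvalues are orthogonal, hence independent, hence finitely
  many. Finiteness is what gives the \<open>Min\<close> in \<open>lambda_min\<close> its
  meaning.\<close>

lemma finite_eigenvalues_symmetric:
  fixes A :: "real^'n^'n"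
  assumes sym: "transpose A = A"
  shows "finite (eigenvalues A)"
proof -
  have "\<forall>c\<in>eigenvalues A. \<exists>v. v \<noteq> 0 \<and> A *v v = c *\<^sub>R v"
    by (auto simp: eigenvalues_def)
  then obtain v where v: "\<And>c. c \<in> eigenvalues A \<Longrightarrow> v c \<noteq> 0"
      "\<And>c. c \<in> eigenvalues A \<Longrightarrow> A *v v c = c *\<^sub>R v c" by metis
  have orth: "v c \<bullet> v c' = 0" if "c \<in> eigenvalues A" "c' \<in> eigenvalues A" "c \<noteq> c'" for c c'
    using inner_mult_symmetric[OF sym, of "v c" "v c'"] that by (simp add: v)
  have inj: "inj_on v (eigenvalues A)"
    using orth v(1) by (metis inj_onI inner_eq_zero_iff)
  have "independent (v ` eigenvalues A)"
  proof (rule pairwise_orthogonal_independent)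
    show "pairwise orthogonal (v ` eigenvalues A)"
      using orth by (auto simp: pairwise_def orthogonal_def)
    show "0 \<notin> v ` eigenvalues A" using v(1) by force
  qed
  then show ?thesis using inj independent_imp_finite finite_imageD by blast
qed

text \<open>A minimiser \<open>v\<close> of the Rayleigh quotient is an eigenvector: \<open>B = A - \<mu>I\<close> is positive
  semidefinite with \<open>v \<bullet> B v = 0\<close>, and then \<open>B v = 0\<close> by first-order optimality.\<close>

lemma symmetric_has_rayleigh_eigenvalue:
  fixes A :: "real^'n^'n"
  assumes sym: "transpose A = A"
  obtains \<mu> where "\<mu> \<in> eigenvalues A" "\<And>x. \<mu> * (x \<bullet> x) \<le> x \<bullet> (A *v x)"
proof -
  have "continuous_on (sphere 0 1) (\<lambda>x. x \<bullet> (A *v x))"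
    by (intro continuous_intros linear_continuous_on matrix_vector_mul_bounded_linear)
  moreover have "sphere (0 :: real^'n) 1 \<noteq> {}" by simp
  ultimately have "\<exists>v\<in>sphere 0 1. \<forall>x\<in>sphere 0 1. v \<bullet> (A *v v) \<le> x \<bullet> (A *v x)"
    by (intro continuous_attains_inf compact_sphere)
  then obtain v where v: "v \<in> sphere 0 1"
      and min: "\<And>x. x \<in> sphere 0 1 \<Longrightarrow> v \<bullet> (A *v v) \<le> x \<bullet> (A *v x)"
    by blast
  define \<mu> where "\<mu> = v \<bullet> (A *v v)"
  have ray: "\<mu> * (x \<bullet> x) \<le> x \<bullet> (A *v x)" for x
  proof (cases "x = 0")
    case False
    have "\<mu> \<le> (x /\<^sub>R norm x) \<bullet> (A *v (x /\<^sub>R norm x))"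
      unfolding \<mu>_def using False by (intro min) simp
    also have "\<dots> = (x \<bullet> (A *v x)) / (x \<bullet> x)"
      by (simp add: matrix_vector_mult_scaleR dot_square_norm power2_eq_square field_simps)
    finally show ?thesis using False by (simp add: field_simps)
  qed simp
  define B where "B x = A *v x - \<mu> *\<^sub>R x" for x
  have Bpos: "0 \<le> x \<bullet> B x" for x using ray[of x] by (simp add: B_def inner_diff_right)
  have vv: "v \<bullet> v = 1" using v by (simp add: dot_square_norm)
  have "v \<bullet> B v = 0" using vv by (simp add: B_def inner_diff_right \<mu>_def)
  have expand: "(v + s *\<^sub>R w) \<bullet> B (v + s *\<^sub>R w) = 2 * s * (w \<bullet> B v) + s\<^sup>2 * (w \<bullet> B w)" for s w
    using \<open>v \<bullet> B v = 0\<close> inner_mult_symmetric[OF sym, of v w]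
    by (simp add: B_def inner_diff_right inner_add_left inner_add_right matrix_vector_right_distrib
        matrix_vector_mult_scaleR inner_commute power2_eq_square algebra_simps)
  have "B v \<bullet> B v \<le> 0"
  proof (rule ccontr)
    assume "\<not> B v \<bullet> B v \<le> 0"
    then have pos: "0 < B v \<bullet> B v" by linarith
    define c where "c = B v \<bullet> B v"
    define q where "q = B v \<bullet> B (B v)"
    \<comment> \<open>Near the minimiser \<open>- c / q\<close> of
      \<open>2 * s * c + s\<^sup>2 * q\<close>; adding \<open>1\<close> to \<open>q\<close> covers
      the case \<open>q = 0\<close>.\<close>
    define s where "s = - (c / (q + 1))"
    have "0 \<le> q" using Bpos by (simp add: q_def)
    have "0 \<le> 2 * s * c + s\<^sup>2 * q" using Bpos[of "v + s *\<^sub>R B v"] expand[of s "B v"]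
      by (simp add: c_def q_def)
    also have "\<dots> = (c\<^sup>2 / (q + 1)) * (q / (q + 1) - 2)"
    proof -
      have "s\<^sup>2 * q = (c\<^sup>2 / (q + 1)) * (q / (q + 1))"
        by (simp add: s_def power2_eq_square)
      moreover have "2 * s * c = (c\<^sup>2 / (q + 1)) * - 2"
        by (simp add: s_def power2_eq_square)
      ultimately show ?thesis by (simp add: right_diff_distrib)
    qed
    also have "\<dots> < 0"
    proof (rule mult_pos_neg)
      show "0 < c\<^sup>2 / (q + 1)" using pos \<open>0 \<le> q\<close> by (simp add: c_def)
      show "q / (q + 1) - 2 < 0" using \<open>0 \<le> q\<close> by (simp add: field_simps)
    qed
    finally show False by simp
  qed
  then have "B v = 0" by (metis inner_gt_zero_iff not_less)
  then have "A *v v = \<mu> *\<^sub>R v" by (simp add: B_def)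
  moreover have "v \<noteq> 0" using vv by auto
  ultimately have "\<mu> \<in> eigenvalues A" by (auto simp: eigenvalues_def)
  then show ?thesis using ray that by blast
qed

lemma lambda_min_in_eigenvalues:
  fixes A :: "real^'n^'n"
  assumes "transpose A = A"
  shows "lambda_min A \<in> eigenvalues A"
  unfolding lambda_min_def
  using symmetric_has_rayleigh_eigenvalue[OF assms] finite_eigenvalues_symmetric[OF assms]
  by (metis Min_in empty_iff)

lemma lambda_min_le_rayleigh:
  fixes A :: "real^'n^'n"
  assumes "transpose A = A"
  shows "lambda_min A * (x \<bullet> x) \<le> x \<bullet> (A *v x)"
proof -
  obtain \<mu> where \<mu>: "\<mu> \<in> eigenvalues A" "\<And>x. \<mu> * (x \<bullet> x) \<le> x \<bullet> (A *v x)"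
    using symmetric_has_rayleigh_eigenvalue[OF assms] by blast
  have "lambda_min A \<le> \<mu>"
    unfolding lambda_min_def using finite_eigenvalues_symmetric[OF assms] \<mu>(1) by simp
  then show ?thesis using \<mu>(2)[of x] by (meson inner_ge_zero mult_right_mono order_trans)
qed

lemma lambda_min_pos:
  fixes A :: "real^'n^'n"
  assumes "transpose A = A" and pd: "\<And>x. x \<noteq> 0 \<Longrightarrow> 0 < x \<bullet> (A *v x)"
  shows "0 < lambda_min A"
proof -
  obtain v where v: "v \<noteq> 0" "A *v v = lambda_min A *\<^sub>R v"
    using lambda_min_in_eigenvalues[OF assms(1)] by (auto simp: eigenvalues_def)
  then have "0 < lambda_min A * (v \<bullet> v)" using pd[of v] by simp
  then show ?thesis using v(1) by (metis inner_gt_zero_iff zero_less_mult_pos2)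
qed

subsection \<open>The kernel of the bearing rigidity matrix\<close>

text \<open>The linear isometry from vectors of blocks, used for positions, to vectors indexed by
  pairs, on which the rigidity matrix and the Laplacian act.\<close>

definition flat :: "(real^'d)^'v \<Rightarrow> real^('v::finite \<times> 'd::finite)" where
  "flat u = (\<chi> a. u $ fst a $ snd a)"

lemma flat_surj: "\<exists>u. z = flat u"
  by (intro exI[of _ "\<chi> i. \<chi> a. z $ (i, a)"]) (simp add: flat_def vec_eq_iff)

lemma flat_eq_iff: "flat u = flat w \<longleftrightarrow> u = w"
  by (auto simp: flat_def vec_eq_iff)

lemma sum_UNIV_prod: "(\<Sum>a\<in>UNIV. f a) = (\<Sum>i\<in>UNIV. \<Sum>b\<in>UNIV. f (i, b))"
  by (simp add: sum.cartesian_product flip: UNIV_Times_UNIV)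

lemma sum_UNIV_Plus: "(\<Sum>i\<in>(UNIV :: ('a::finite + 'b::finite) set). f i)
    = (\<Sum>a\<in>UNIV. f (Inl a)) + (\<Sum>b\<in>UNIV. f (Inr b))"
  by (simp add: sum.Plus flip: UNIV_Plus_UNIV)

lemma inner_flat: "flat u \<bullet> flat w = u \<bullet> w"
  by (simp add: inner_vec_def flat_def sum_UNIV_prod)

lemma projector_mult: "projector g *v x = x - (g \<bullet> x) *\<^sub>R g"
proof -
  have "(\<chi> a b. g $ a * g $ b) *v x = (g \<bullet> x) *\<^sub>R g"
    by (simp add: matrix_vector_mult_def vec_eq_iff inner_vec_def sum_distrib_left mult_ac)
  then show ?thesis by (simp add: projector_def matrix_vector_mult_diff_rdistrib)
qed

lemma projector_minus: "projector (- g) = projector g"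
  by (simp add: projector_def)

lemma inner_projector: "x \<bullet> (projector g *v y) = (projector g *v x) \<bullet> y"
  by (simp add: projector_mult inner_diff_left inner_diff_right inner_commute)

lemma bearing_commute: "bearing p j i = - bearing p i j"
  by (simp add: bearing_def norm_minus_commute flip: scaleR_minus_right)

lemma projector_bearing: "projector (bearing p i j) *v (p $ j - p $ i) = 0"
  by (simp add: projector_mult bearing_def dot_square_norm power2_eq_square)

text \<open>Loops must be excluded: by the order of the cases in \<open>incidence\<close>, a loop
  would get the entry \<open>-1\<close>, although its difference is \<open>0\<close>.\<close>

lemma incidence_sum:
  assumes "fst (e k) \<noteq> snd (e k)"
  shows "(\<Sum>i\<in>UNIV. incidence e $ k $ i * f i) = f (snd (e k)) - f (fst (e k))"
proof -
  have "(\<Sum>i\<in>UNIV. incidence e $ k $ i * f i) = (\<Sum>i\<in>UNIV. (if i = snd (e k) then f i else 0) - (if i = fst (e k) then f i else 0))"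
    using assms by (intro sum.cong) (auto simp: incidence_def)
  then show ?thesis by (simp add: sum_subtractf)
qed

lemma rigidity_matrix_mult_flat:
  assumes "fst (e k) \<noteq> snd (e k)"
  shows "(rigidity_matrix e p *v flat u) $ (k, a)
    = (projector (bearing p (fst (e k)) (snd (e k))) *v (u $ snd (e k) - u $ fst (e k))) $ a"
proof -
  have kron: "(kron_id (incidence e) *v flat u) $ (k, b) = (u $ snd (e k) - u $ fst (e k)) $ b" for b
  proof -
    have "(kron_id (incidence e) *v flat u) $ (k, b)
        = (\<Sum>i\<in>UNIV. \<Sum>c\<in>UNIV. if c = b then incidence e $ k $ i * u $ i $ b else 0)"
      unfolding matrix_vector_mult_def vec_lambda_beta sum_UNIV_prod
      by (intro sum.cong refl) (simp add: kron_id_def flat_def mat_def)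
    also have "\<dots> = (\<Sum>i\<in>UNIV. incidence e $ k $ i * u $ i $ b)" by simp
    also have "\<dots> = (u $ snd (e k) - u $ fst (e k)) $ b" using incidence_sum[of e k, OF assms] by simp
    finally show ?thesis .
  qed
  have blk: "(blkdiag M *v z) $ (k, a) = (\<Sum>b\<in>UNIV. M k $ a $ b * z $ (k, b))" for M z
  proof -
    have "(blkdiag M *v z) $ (k, a)
       = (\<Sum>i\<in>UNIV. \<Sum>b\<in>UNIV. if i = k then M k $ a $ b * z $ (k, b) else 0)"
      unfolding matrix_vector_mult_def vec_lambda_beta sum_UNIV_prod
      by (intro sum.cong refl) (auto simp: blkdiag_def)
    also have "\<dots> = (\<Sum>i\<in>UNIV. if i = k then \<Sum>b\<in>UNIV. M k $ a $ b * z $ (k, b) else 0)"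
      by (intro sum.cong refl) simp
    finally show ?thesis by simp
  qed
  show ?thesis
    unfolding rigidity_matrix_def matrix_vector_mul_assoc[symmetric] blk kron
    by (simp add: matrix_vector_mult_def)
qed

lemma norm_rigidity_matrix_mult_flat:
  assumes "\<And>k. fst (e k) \<noteq> snd (e k)"
  shows "(norm (rigidity_matrix e p *v flat u))\<^sup>2
    = (\<Sum>k\<in>UNIV. (norm (projector (bearing p (fst (e k)) (snd (e k))) *v (u $ snd (e k) - u $ fst (e k))))\<^sup>2)"
  unfolding power2_norm_eq_inner inner_vec_def[of "rigidity_matrix e p *v flat u"] sum_UNIV_prod
    rigidity_matrix_mult_flat[where e = e, OF assms]
  by (simp add: inner_vec_def)

text \<open>The kernel is the orthogonal complement of the row space, whose dimension is the
  rank.\<close>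

lemma dim_kernel:
  fixes A :: "real^'n^'m"
  shows "dim {x. A *v x = 0} + rank A = CARD('n)"
proof -
  have "A *v x = 0 \<longleftrightarrow> (\<forall>y\<in>span (rows A). orthogonal y x)" for x
  proof
    assume "A *v x = 0"
    then have "A $ i \<bullet> x = 0" for i by (simp add: matrix_mult_dot vec_eq_iff)
    then have "\<forall>y\<in>rows A. orthogonal x y"
      by (auto simp: rows_def row_def orthogonal_def inner_commute vec_lambda_eta)
    then show "\<forall>y\<in>span (rows A). orthogonal y x"
      using orthogonal_to_span by (metis orthogonal_commute)
  next
    assume *: "\<forall>y\<in>span (rows A). orthogonal y x"
    have "A $ i \<in> span (rows A)" for i
      by (rule span_base) (auto simp: rows_def row_def vec_lambda_eta)
    then show "A *v x = 0" using * by (auto simp: matrix_mult_dot vec_eq_iff orthogonal_def)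
  qed
  then show ?thesis
    using dim_subspace_orthogonal_to_vectors[of "span (rows A)" "UNIV :: (real^'n) set"]
    by (simp add: row_rank_def)
qed

text \<open>Translations and scalings of \<open>p\<close> form a \<open>(d + 1)\<close>-dimensional subspace of the kernel, which
  by the rank condition is the whole kernel.\<close>

lemma rigidity_kernel:
  fixes p :: "(real^'d)^'v::finite" and e :: "'m::finite \<Rightarrow> 'v \<times> 'v"
  assumes loops: "\<And>k. fst (e k) \<noteq> snd (e k)" and inj: "inj (\<lambda>i. p $ i)" and card: "3 \<le> CARD('v)"
    and rigid: "infinitesimally_bearing_rigid e p"
    and ker: "rigidity_matrix e p *v flat u = 0"
  shows "\<exists>a s. \<forall>i. u $ i = a + s *\<^sub>R p $ i"
proof -
  define T :: "(real^'d) \<times> real \<Rightarrow> real^('v \<times> 'd)" where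
    "T = (\<lambda>(a, s). flat (\<chi> i. a + s *\<^sub>R p $ i))"
  have "linear T"
    by (rule linearI) (auto simp: T_def flat_def vec_eq_iff algebra_simps)
  obtain i j :: 'v where "i \<noteq> j"
  proof -
    have "\<not> is_singleton (UNIV :: 'v set)" using card by (auto simp: is_singleton_altdef)
    then show ?thesis using that by (metis UNIV_I UNIV_eq_I insertI1 is_singletonI singletonD)
  qed
  then have "p $ i \<noteq> p $ j" using inj by (metis injD)
  have "inj T"
    unfolding linear_injective_0[OF \<open>linear T\<close>]
  proof (intro allI impI)
    fix as assume T0: "T as = 0"
    obtain a s where as: "as = (a, s)" by fastforce
    have eq: "a + s *\<^sub>R p $ k = 0" for k
      using T0 by (simp add: as T_def flat_def vec_eq_iff)
    then have "s *\<^sub>R (p $ i - p $ j) = 0"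
      unfolding scaleR_diff_right by (metis add_left_cancel eq_iff_diff_eq_0)
    then have "s = 0" using \<open>p $ i \<noteq> p $ j\<close> by simp
    then show "as = 0" using eq by (simp add: as zero_prod_def)
  qed
  have "dim (range T) = CARD('d) + 1"
    using dim_image_eq[OF \<open>linear T\<close>, of UNIV] \<open>inj T\<close> by simp
  moreover have "dim {z. rigidity_matrix e p *v z = 0} = CARD('d) + 1"
  proof -
    \<comment> \<open>The rank condition subtracts natural numbers; it determines the dimension of
      the kernel only once \<open>d + 1 \<le> d * n\<close> is known.\<close>
    have "CARD('d) * 3 \<le> CARD('d) * CARD('v)" using card by simp
    moreover have "1 \<le> CARD('d)" by (simp add: Suc_le_eq)
    ultimately have "CARD('d) + 1 \<le> CARD('d) * CARD('v)" by linarith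
    then show ?thesis
      using dim_kernel[of "rigidity_matrix e p"] rigid
      by (simp add: infinitesimally_bearing_rigid_def mult.commute)
  qed
  moreover have "range T \<subseteq> {z. rigidity_matrix e p *v z = 0}"
  proof clarify
    fix a s
    have "rigidity_matrix e p *v flat (\<chi> i. a + s *\<^sub>R p $ i) = 0"
      by (auto simp: vec_eq_iff rigidity_matrix_mult_flat[where e = e, OF loops] matrix_vector_mult_scaleR
          projector_bearing simp flip: scaleR_diff_right)
    then show "rigidity_matrix e p *v T (a, s) = 0" by (simp add: T_def)
  qed
  moreover have "subspace {z. rigidity_matrix e p *v z = 0}"
    by (simp add: subspace_def matrix_vector_right_distrib matrix_vector_mult_scaleR)
  moreover have "subspace (range T)" using \<open>linear T\<close> by (simp add: linear_subspace_image)
  ultimately have "range T = {z. rigidity_matrix e p *v z = 0}"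
    by (intro subspace_dim_equal) auto
  then obtain as where "flat u = T as" using ker by blast
  then show ?thesis
    by (cases as) (auto simp: T_def flat_eq_iff)
qed

section \<open>Positive definiteness of the follower block\<close>

definition extend :: "(real^'d)^'f \<Rightarrow> (real^'d)^('l::finite + 'f::finite)" where
  "extend u = (\<chi> i. case i of Inl a \<Rightarrow> 0 | Inr b \<Rightarrow> u $ b)"

text \<open>On vectors that vanish at the leaders, the quadratic form of the whole Laplacian sees
  only its follower block, and the Laplacian is a Gram matrix.\<close>

lemma follower_block_quadratic:
  fixes u :: "(real^'d)^'f::finite" and p :: "(real^'d)^('l::finite + 'f)"
  shows "flat u \<bullet> (follower_block (bearing_laplacian e p) *v flat u)
    = (norm (rigidity_matrix e p *v flat (extend u :: (real^'d)^('l + 'f))))\<^sup>2"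
proof -
  let ?R = "rigidity_matrix e p" and ?z = "flat (extend u :: (real^'d)^('l + 'f))"
  have "flat u \<bullet> (follower_block L *v flat u) = ?z \<bullet> (L *v ?z)" for L
    by (simp add: inner_vec_def matrix_vector_mult_def sum_UNIV_prod sum_UNIV_Plus flat_def
        extend_def follower_block_def)
  then have "flat u \<bullet> (follower_block (bearing_laplacian e p) *v flat u)
      = ?z \<bullet> (transpose ?R *v (?R *v ?z))"
    by (simp add: bearing_laplacian_def matrix_vector_mul_assoc)
  also have "\<dots> = (?R *v ?z) \<bullet> (?R *v ?z)"
    by (metis dot_lmul_matrix inner_commute transpose_matrix_vector)
  finally show ?thesis by (simp add: power2_norm_eq_inner)
qed

lemma follower_block_symmetric:
  "transpose (follower_block (bearing_laplacian e p)) = follower_block (bearing_laplacian e p)"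
proof -
  have "transpose (bearing_laplacian e p) = bearing_laplacian e p"
    by (simp add: bearing_laplacian_def matrix_transpose_mul)
  then show ?thesis by (simp add: follower_block_def transpose_def vec_eq_iff)
qed

text \<open>A kernel vector is a translation plus a scaling of the target. If it vanishes at two
  leaders, whose positions differ, then the scaling factor is zero and so is the
  translation.\<close>

lemma follower_block_lambda_min_pos:
  fixes p :: "(real^'d)^('l::finite + 'f::finite)"
  assumes loops: "\<And>k. fst (e k) \<noteq> snd (e k)" and inj: "inj (\<lambda>i. p $ i)"
    and leaders: "2 \<le> CARD('l)" and rigid: "infinitesimally_bearing_rigid e p"
  shows "0 < lambda_min (follower_block (bearing_laplacian e p))"
proof (rule lambda_min_pos[OF follower_block_symmetric])
  fix z :: "real^('f \<times> 'd)" assume "z \<noteq> 0"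
  obtain u where z: "z = flat u" using flat_surj by blast
  have "rigidity_matrix e p *v flat (extend u :: (real^'d)^('l + 'f)) \<noteq> 0"
  proof
    assume "rigidity_matrix e p *v flat (extend u :: (real^'d)^('l + 'f)) = 0"
    moreover have "3 \<le> CARD('l + 'f)" 
  proof -
    have "0 < CARD('f)" by (rule zero_less_card_finite)
    moreover have "CARD('l + 'f) = CARD('l) + CARD('f)" by simp
    ultimately show ?thesis using leaders by linarith
  qed
    ultimately obtain a s where as: "\<And>i. (extend u :: (real^'d)^('l + 'f)) $ i = a + s *\<^sub>R p $ i"
      using rigidity_kernel[OF loops inj _ rigid] by metis
    obtain i j :: 'l where "i \<noteq> j"
    proof -
      have "\<not> is_singleton (UNIV :: 'l set)" using leaders by (auto simp: is_singleton_altdef)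
      then show ?thesis using that by (metis UNIV_I UNIV_eq_I insertI1 is_singletonI singletonD)
    qed
    have lead: "a + s *\<^sub>R p $ Inl k = 0" for k using as[of "Inl k"] by (simp add: extend_def)
    then have "s *\<^sub>R (p $ Inl i - p $ Inl j) = 0"
      unfolding scaleR_diff_right by (metis add_left_cancel eq_iff_diff_eq_0)
    moreover have "p $ Inl i \<noteq> p $ Inl j" using inj \<open>i \<noteq> j\<close> by (metis Inl_inject injD)
    ultimately have "s = 0" by simp
    then have "a = 0" using lead by simp
    have "u $ b = 0" for b using as[of "Inr b"] \<open>s = 0\<close> \<open>a = 0\<close> by (simp add: extend_def)
    then have "u = 0" by (simp add: vec_eq_iff)
    then show False using \<open>z \<noteq> 0\<close> z by (simp add: flat_def vec_eq_iff)
  qed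
  then show "0 < z \<bullet> (follower_block (bearing_laplacian e p) *v z)"
    unfolding z follower_block_quadratic by simp
qed

text \<open>With \<open>q\<^sub>k\<close> the projected difference along edge \<open>k\<close>, the
  Rayleigh bound gives \<open>\<lambda> |D|\<^sup>2 \<le> \<Sum>\<^sub>k
  |q\<^sub>k|\<^sup>2\<close>, and the right side is at most the square of
  \<open>\<Sum>\<^sub>k |q\<^sub>k|\<^sub>1\<close>. A root and the comparison of the 1-norm with
  the 2-norm of \<open>D\<close> produce the constant.\<close>

lemma l1norm_extend_le:
  fixes p :: "(real^'d)^('l::finite + 'f::finite)" and u :: "(real^'d)^'f"
  assumes loops: "\<And>k. fst (e k) \<noteq> snd (e k)" and inj: "inj (\<lambda>i. p $ i)"
    and leaders: "2 \<le> CARD('l)" and rigid: "infinitesimally_bearing_rigid e p"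
  defines "D \<equiv> extend u :: (real^'d)^('l + 'f)"
  shows "l1norm D \<le>
    sqrt (real (CARD('d) * CARD('l + 'f)) / lambda_min (follower_block (bearing_laplacian e p)))
    * (\<Sum>k\<in>UNIV. l1norm (projector (bearing p (fst (e k)) (snd (e k))) *v (D $ fst (e k) - D $ snd (e k))))"
proof -
  let ?l = "lambda_min (follower_block (bearing_laplacian e p))"
  let ?q = "\<lambda>k. projector (bearing p (fst (e k)) (snd (e k))) *v (D $ fst (e k) - D $ snd (e k))"
  have lpos: "0 < ?l" using follower_block_lambda_min_pos[OF loops inj leaders rigid] .
  have q: "projector (bearing p (fst (e k)) (snd (e k))) *v (D $ snd (e k) - D $ fst (e k)) = - ?q k" for k
    by (simp add: projector_mult inner_diff_right algebra_simps)
  have DD: "D \<bullet> D = flat u \<bullet> flat u"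
    unfolding inner_flat by (simp add: D_def extend_def inner_vec_def sum_UNIV_Plus)
  have "?l * (norm D)\<^sup>2 \<le> (norm (rigidity_matrix e p *v flat D))\<^sup>2"
    using lambda_min_le_rayleigh[OF follower_block_symmetric, of e p "flat u"]
    unfolding follower_block_quadratic power2_norm_eq_inner[of D] DD unfolding D_def .
  also have "\<dots> = (\<Sum>k\<in>UNIV. (norm (?q k))\<^sup>2)"
    unfolding norm_rigidity_matrix_mult_flat[where e = e, OF loops] q by simp
  also have "\<dots> \<le> (\<Sum>k\<in>UNIV. l1norm (?q k))\<^sup>2"
  proof -
    have "L2_set (\<lambda>k. norm (?q k)) UNIV \<le> (\<Sum>k\<in>UNIV. norm (?q k))"
      by (rule L2_set_le_sum) simp
    also have "\<dots> \<le> (\<Sum>k\<in>UNIV. l1norm (?q k))" by (intro sum_mono norm_le_l1norm)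
    finally show ?thesis unfolding L2_set_def
      by (rule sqrt_le_D)
  qed
  finally have "(sqrt ?l * norm D)\<^sup>2 \<le> (\<Sum>k\<in>UNIV. l1norm (?q k))\<^sup>2"
    using lpos by (simp add: power_mult_distrib)
  then have "sqrt ?l * norm D \<le> (\<Sum>k\<in>UNIV. l1norm (?q k))"
    by (rule power2_le_imp_le) (simp add: sum_nonneg l1norm_nonneg)
  then have *: "norm D \<le> (\<Sum>k\<in>UNIV. l1norm (?q k)) / sqrt ?l"
    using lpos by (simp add: field_simps)
  have "l1norm D \<le> sqrt (real (CARD('d) * CARD('l + 'f))) * norm D"
    using l1norm_le_norm[of D] by (simp add: mult.commute)
  also have "\<dots> \<le> sqrt (real (CARD('d) * CARD('l + 'f))) * ((\<Sum>k\<in>UNIV. l1norm (?q k)) / sqrt ?l)"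
    using * by (rule mult_left_mono) simp
  finally show ?thesis by (simp add: real_sqrt_divide)
qed

subsection \<open>The closed loop\<close>

locale bearing_formation =
  fixes E :: "('l::finite + 'f::finite) set set"
    and e :: "'m::finite \<Rightarrow> ('l + 'f) \<times> ('l + 'f)"
    and pstar :: "(real^'d)^('l + 'f)"
    and dstb :: "real \<Rightarrow> (real^'d)^('l + 'f)"
    and N :: nat and \<rho> :: "'r::finite \<Rightarrow> nat"
  assumes leaders: "2 \<le> CARD('l)"
    and graph: "simple_graph E" "oriented_edges E e"
    and target: "inj (\<lambda>i. pstar $ i)" "infinitesimally_bearing_rigid e pstar"
    and exponents: "bij_betw \<rho> UNIV {0..N}"
begin

definition pfol :: "(real^'d)^'f" where
  "pfol = (\<chi> b. pstar $ Inr b)"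

abbreviation dev :: "('d, 'f, 'm, 'r) state \<Rightarrow> (real^'d)^('l + 'f)" where
  "dev y \<equiv> positions pstar y - pstar"

definition q :: "'m \<Rightarrow> ('d, 'f, 'm, 'r) state \<Rightarrow> real^'d" where
  "q k y = q_vec pstar (positions pstar y) (fst (e k)) (snd (e k))"

definition Q :: "'m \<Rightarrow> ('d, 'f, 'm, 'r) state \<Rightarrow> real" where
  "Q k y = l1norm (q k y)"

text \<open>The constant \<open>c\<close> of the overview, whose powers appear in the finite-time
  condition.\<close>

definition rigidity_const :: real where
  "rigidity_const = sqrt (real (CARD('d) * CARD('l + 'f)) / lambda_min (follower_block (bearing_laplacian e pstar)))"

abbreviation F :: "real \<Rightarrow> ('d, 'f, 'm, 'r) state \<Rightarrow> ('d, 'f, 'm, 'r) state" where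
  "F \<equiv> closed_loop N \<rho> E e pstar dstb"

lemma Q_nonneg: "0 \<le> Q k y"
  by (simp add: Q_def l1norm_nonneg)

lemma edges_bij: "bij_betw (\<lambda>k. {fst (e k), snd (e k)}) UNIV E"
  using graph(2) by (simp add: oriented_edges_def)

lemma edge_mem: "{fst (e k), snd (e k)} \<in> E"
  using edges_bij by (auto simp: bij_betw_def)

lemma edge_ex: "\<epsilon> \<in> E \<Longrightarrow> \<exists>k. \<epsilon> = {fst (e k), snd (e k)}"
  using edges_bij by (auto simp: bij_betw_def)

lemma edge_inj: "{fst (e k), snd (e k)} = {fst (e k'), snd (e k')} \<Longrightarrow> k = k'"
  using edges_bij by (auto simp: bij_betw_def dest: injD)

lemma no_loops: "fst (e k) \<noteq> snd (e k)"
proof -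
  have "card {fst (e k), snd (e k)} = 2" using graph(1) edge_mem by (auto simp: simple_graph_def)
  then show ?thesis by auto
qed

lemma edge_index_eq: "edge_index e i j = k" if "{fst (e k), snd (e k)} = {i, j}"
  unfolding edge_index_def using that edge_inj by (intro the_equality) auto

lemma dev_extend: "dev y = extend (fst y - pfol)"
  by (simp add: vec_eq_iff positions_def extend_def pfol_def split: sum.split)

lemma norm_dev: "norm (dev y) = norm (fst y - pfol)"
  unfolding dev_extend norm_eq_sqrt_inner by (simp add: extend_def inner_vec_def sum_UNIV_Plus)

text \<open>The target displacement of \<open>i\<close> and \<open>j\<close> is parallel to the
  bearing that the projector annihilates, so only the deviation from the target remains.\<close>

lemma q_vec_dev: "q_vec pstar (positions pstar y) i j = projector (bearing pstar i j) *v (dev y $ i - dev y $ j)"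
proof -
  have "positions pstar y $ i - positions pstar y $ j = (dev y $ i - dev y $ j) - (pstar $ j - pstar $ i)"
    by simp
  then show ?thesis
    by (metis diff_zero matrix_vector_mult_diff_distrib projector_bearing q_vec_def)
qed

lemma q_vec_swap: "q_vec pstar p j i = - q_vec pstar p i j"
proof -
  have "p $ j - p $ i = - (p $ i - p $ j)" by simp
  then show ?thesis unfolding q_vec_def bearing_commute[of pstar i j] projector_minus
    by (simp only: projector_mult inner_minus_right) simp
qed

lemma rigidity_const_pos: "0 < rigidity_const"
  unfolding rigidity_const_def real_sqrt_gt_0_iff
  by (rule divide_pos_pos[OF _ follower_block_lambda_min_pos[OF no_loops target(1) leaders target(2)]])
    (simp only: of_nat_0_less_iff mult_pos_pos zero_less_card_finite)

lemma l1norm_dev_le: "l1norm (dev y) \<le> rigidity_const * (\<Sum>k\<in>UNIV. Q k y)"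
  using l1norm_extend_le[OF no_loops target(1) leaders target(2), of "fst y - pfol"]
  unfolding Q_def q_def q_vec_dev rigidity_const_def dev_extend .

text \<open>Each undirected edge is visited once from either end: the ordered pairs of neighbours
  are the oriented edges together with their reversals.\<close>

lemma sum_neighbours:
  fixes G :: "'l + 'f \<Rightarrow> 'l + 'f \<Rightarrow> real"
  shows "(\<Sum>i\<in>UNIV. \<Sum>j\<in>nbrs E i. G i j)
    = (\<Sum>k\<in>UNIV. G (fst (e k)) (snd (e k)) + G (snd (e k)) (fst (e k)))"
proof -
  have "(\<Sum>i\<in>UNIV. \<Sum>j\<in>nbrs E i. G i j) = (\<Sum>(i, j)\<in>(SIGMA i:UNIV. nbrs E i). G i j)"
    by (rule sum.Sigma) auto
  also have "(SIGMA i:UNIV. nbrs E i) = range e \<union> range (prod.swap \<circ> e)"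
  proof (intro set_eqI iffI)
    fix a assume a: "a \<in> (SIGMA i:UNIV. nbrs E i)"
    then obtain k where "{fst a, snd a} = {fst (e k), snd (e k)}"
      using edge_ex by (force simp: nbrs_def)
    then have "a = e k \<or> a = prod.swap (e k)"
      by (auto simp: doubleton_eq_iff prod_eq_iff)
    then show "a \<in> range e \<union> range (prod.swap \<circ> e)" by auto
  next
    fix a assume "a \<in> range e \<union> range (prod.swap \<circ> e)"
    then obtain k where "a = e k \<or> a = prod.swap (e k)" by auto
    then have "{fst a, snd a} \<in> E" using edge_mem[of k] by (auto simp: insert_commute)
    then show "a \<in> (SIGMA i:UNIV. nbrs E i)" by (cases a) (simp add: nbrs_def)
  qed
  also have "(\<Sum>(i, j)\<in>range e \<union> range (prod.swap \<circ> e). G i j)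
      = (\<Sum>(i, j)\<in>range e. G i j) + (\<Sum>(i, j)\<in>range (prod.swap \<circ> e). G i j)"
  proof (rule sum.union_disjoint)
    \<comment> \<open>An oriented edge that is the reversal of another has the same vertex set,
      hence the same index, and would be its own reversal, that is, a loop.\<close>
    show "range e \<inter> range (prod.swap \<circ> e) = {}"
    proof (rule ccontr)
      assume "range e \<inter> range (prod.swap \<circ> e) \<noteq> {}"
      then obtain a where "a \<in> range e" "a \<in> range (prod.swap \<circ> e)" by blast
      then obtain k k' where "a = e k" "a = prod.swap (e k')" unfolding image_iff o_def by blast
      then have kk: "e k = prod.swap (e k')" by simp
      then have "k = k'" using edge_inj[of k k'] by (simp add: insert_commute)
      then have "fst (e k) = snd (e k)" using kk fst_swap by metis
      then show False using no_loops by blast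
    qed
  qed auto
  also have "(\<Sum>(i, j)\<in>range e. G i j) = (\<Sum>k\<in>UNIV. G (fst (e k)) (snd (e k)))"
  proof (subst sum.reindex)
    show "inj e" using edge_inj by (auto intro: injI)
  qed (simp add: case_prod_unfold)
  also have "(\<Sum>(i, j)\<in>range (prod.swap \<circ> e). G i j) = (\<Sum>k\<in>UNIV. G (snd (e k)) (fst (e k)))"
  proof (subst sum.reindex)
    show "inj (prod.swap \<circ> e)" using edge_inj by (auto intro!: injI simp: prod_eq_iff)
  qed (simp add: case_prod_unfold)
  finally show ?thesis by (simp add: sum.distrib)
qed

text \<open>Both ends of an edge apply the same gain, because \<open>q\<close> only changes sign
  with the orientation and the adaptive parameters belong to the undirected edge.\<close>

lemma gain_edge:
  "gain N \<rho> e pstar y (fst (e k)) (snd (e k)) = (\<Sum>s\<in>UNIV. snd y $ s $ k * Q k y ^ \<rho> s)"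
  "gain N \<rho> e pstar y (snd (e k)) (fst (e k)) = (\<Sum>s\<in>UNIV. snd y $ s $ k * Q k y ^ \<rho> s)"
proof -
  have inv: "inv \<rho> (\<rho> s) = s" for s
    using exponents by (simp add: bij_betw_def inv_f_f)
  have "(\<Sum>r=0..N. beta_hat \<rho> y r $ k * Q k y ^ r) = (\<Sum>s\<in>UNIV. snd y $ s $ k * Q k y ^ \<rho> s)"
    unfolding sum.reindex_bij_betw[OF exponents, symmetric] by (simp add: beta_hat_def inv)
  moreover have "edge_index e (fst (e k)) (snd (e k)) = k" "edge_index e (snd (e k)) (fst (e k)) = k"
    by (rule edge_index_eq; auto)+
  moreover have "l1norm (q_vec pstar (positions pstar y) (snd (e k)) (fst (e k))) = Q k y"
    unfolding Q_def q_def using q_vec_swap by (metis l1norm_minus)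
  ultimately show
    "gain N \<rho> e pstar y (fst (e k)) (snd (e k)) = (\<Sum>s\<in>UNIV. snd y $ s $ k * Q k y ^ \<rho> s)"
    "gain N \<rho> e pstar y (snd (e k)) (fst (e k)) = (\<Sum>s\<in>UNIV. snd y $ s $ k * Q k y ^ \<rho> s)"
    by (simp_all add: gain_def Q_def q_def)
qed

text \<open>Each edge contributes \<open>\<gamma> sgn q \<bullet> P (\<delta> i - \<delta> j) = \<gamma> sgn q \<bullet> q\<close>; the stationary leaders drop out.\<close>

lemma inner_control:
  "(\<Sum>b\<in>UNIV. (fst y - pfol) $ b \<bullet> control N \<rho> E e pstar y (Inr b))
    = - (\<Sum>k\<in>UNIV. \<Sum>s\<in>UNIV. snd y $ s $ k * Q k y ^ (\<rho> s + 1))"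
proof -
  let ?P = "positions pstar y"
  define G where "G i j = gain N \<rho> e pstar y i j *
    (dev y $ i \<bullet> (projector (bearing pstar i j) *v sgn_vec (q_vec pstar ?P i j)))" for i j
  have edge: "G (fst (e k)) (snd (e k)) + G (snd (e k)) (fst (e k))
      = (\<Sum>s\<in>UNIV. snd y $ s $ k * Q k y ^ (\<rho> s + 1))" for k
  proof -
    let ?i = "fst (e k)" and ?j = "snd (e k)"
    let ?A = "projector (bearing pstar ?i ?j)"
    have "projector (bearing pstar ?j ?i) = ?A"
      using bearing_commute projector_minus by metis
    moreover have "q_vec pstar ?P ?j ?i = - q k y" unfolding q_def by (rule q_vec_swap)
    moreover have "q_vec pstar ?P ?i ?j = q k y" unfolding q_def ..
    moreover have "?A *v (- z) = - (?A *v z)" for z by (simp add: projector_mult)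
    \<comment> \<open>The two ends see \<open>sgn q\<close> with opposite signs, which turns the sum
      of their terms into a product with \<open>\<delta> i - \<delta> j\<close>.\<close>
    ultimately have "G ?i ?j + G ?j ?i = (\<Sum>s\<in>UNIV. snd y $ s $ k * Q k y ^ \<rho> s) *
        (dev y $ ?i \<bullet> (?A *v sgn_vec (q k y)) - dev y $ ?j \<bullet> (?A *v sgn_vec (q k y)))"
      unfolding G_def gain_edge
      by (simp only: sgn_vec_minus inner_minus_right right_diff_distrib)
    also have "dev y $ ?i \<bullet> (?A *v sgn_vec (q k y)) - dev y $ ?j \<bullet> (?A *v sgn_vec (q k y))
        = (dev y $ ?i - dev y $ ?j) \<bullet> (?A *v sgn_vec (q k y))"
      by (simp add: inner_diff_left)
    also have "\<dots> = q k y \<bullet> sgn_vec (q k y)"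
      unfolding inner_projector q_def q_vec_dev ..
    also have "\<dots> = Q k y" by (simp add: inner_commute[of "q k y"] sgn_vec_inner_self Q_def)
    finally show ?thesis by (simp add: sum_distrib_right mult.assoc mult.commute[of "Q k y"])
  qed
  have "(\<Sum>b\<in>UNIV. (fst y - pfol) $ b \<bullet> control N \<rho> E e pstar y (Inr b))
      = (\<Sum>i\<in>UNIV. dev y $ i \<bullet> control N \<rho> E e pstar y i)"
    unfolding dev_extend sum_UNIV_Plus by (simp add: extend_def)
  also have "\<dots> = - (\<Sum>i\<in>UNIV. \<Sum>j\<in>nbrs E i. G i j)"
    by (simp add: control_def inner_sum_right G_def sum_negf del: vector_minus_component)
  also have "\<dots> = - (\<Sum>k\<in>UNIV. G (fst (e k)) (snd (e k)) + G (snd (e k)) (fst (e k)))"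
    unfolding sum_neighbours ..
  also have "\<dots> = - (\<Sum>k\<in>UNIV. \<Sum>s\<in>UNIV. snd y $ s $ k * Q k y ^ (\<rho> s + 1))"
    unfolding edge ..
  finally show ?thesis .
qed

text \<open>The right side is continuous in \<open>y\<close> although \<open>F t\<close> is not, as
  \<open>filippov_map_inner\<close> requires.\<close>

lemma inner_closed_loop:
  "(fst y - pfol) \<bullet> fst (F t y) = - (\<Sum>k\<in>UNIV. \<Sum>s\<in>UNIV. snd y $ s $ k * Q k y ^ (\<rho> s + 1))
    + (fst y - pfol) \<bullet> (\<chi> b. dstb t $ Inr b)"
  unfolding inner_control[symmetric]
  by (simp add: closed_loop_def inner_vec_def[of "fst y - pfol"] inner_add_right sum.distrib)

lemma snd_closed_loop: "snd (F t y) $ s $ k = Q k y ^ (\<rho> s + 1)"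
  by (simp add: closed_loop_def Q_def q_def)

section \<open>Continuity, local boundedness and Filippov velocities of the right-hand side\<close>

lemma continuous_positions: "continuous (at x) (\<lambda>y. positions pstar y $ i)"
  by (cases i) (auto simp: positions_def intro!: continuous_intros)

lemma continuous_q_vec: "continuous (at x) (\<lambda>y. q_vec pstar (positions pstar y) i j)"
  unfolding q_vec_def projector_mult by (intro continuous_intros continuous_positions)

lemma continuous_Q: "continuous (at x) (Q k)"
  unfolding Q_def q_def by (intro continuous_intros continuous_q_vec)

lemma continuous_gain: "continuous (at x) (\<lambda>y. gain N \<rho> e pstar y i j)"
  unfolding gain_def beta_hat_def by (intro continuous_intros continuous_q_vec)

text \<open>The discontinuous factor \<open>sgn_vec\<close> has entries of modulus at most
  \<open>1\<close>, everything else depending on the state is continuous on a compact ball, and the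
  disturbance is constant for fixed \<open>t\<close>.\<close>

lemma bounded_closed_loop: "bounded (F t ` ball x 1)"
proof -
  have compact_bdd: "bounded (f ` ball x 1)" if "\<And>x. continuous (at x) f"
    for f :: "('d, 'f, 'm, 'r) state \<Rightarrow> real"
  proof -
    have "continuous_on (cball x 1) f" using that by (simp add: continuous_at_imp_continuous_on)
    then have "bounded (f ` cball x 1)" by (intro compact_imp_bounded compact_continuous_image) auto
    then show ?thesis using bounded_subset ball_subset_cball by (metis image_mono)
  qed
  have bdd_vec: "bounded ((\<lambda>y. \<chi> i. f i y) ` S)" if "\<And>i. bounded (f i ` S)"
    for f :: "'i::finite \<Rightarrow> 'x \<Rightarrow> 'y::real_normed_vector" and S
  proof -
    have "\<forall>i. \<exists>B. \<forall>y\<in>S. norm (f i y) \<le> B" using that by (simp add: bounded_iff)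
    then obtain B where B: "\<And>i y. y \<in> S \<Longrightarrow> norm (f i y) \<le> B i" by metis
    have "norm (\<chi> i. f i y) \<le> (\<Sum>i\<in>UNIV. B i)" if "y \<in> S" for y
    proof -
      have "norm (\<chi> i. f i y) \<le> (\<Sum>i\<in>UNIV. norm (f i y))"
        unfolding norm_vec_def using L2_set_le_sum[of UNIV "\<lambda>i. norm (f i y)"] by simp
      also have "\<dots> \<le> (\<Sum>i\<in>UNIV. B i)" by (intro sum_mono B that)
      finally show ?thesis .
    qed
    then show ?thesis by (auto simp: bounded_iff)
  qed
  have sgn_bdd: "norm (M *v sgn_vec z) \<le> onorm ((*v) M) * real CARD('d)" for M :: "real^'d^'d" and z
  proof -
    have "norm (sgn_vec z) \<le> (\<Sum>a\<in>UNIV. \<bar>sgn_vec z $ a\<bar>)" by (rule norm_le_l1_cart)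
    also have "\<dots> \<le> (\<Sum>a\<in>(UNIV :: 'd set). 1)" by (intro sum_mono) (simp add: sgn_vec_def abs_sgn_eq)
    finally have "norm (sgn_vec z) \<le> real CARD('d)" by simp
    then show ?thesis
      using onorm[OF matrix_vector_mul_bounded_linear[of M], of "sgn_vec z"]
      by (meson matrix_vector_mul_bounded_linear mult_left_mono onorm_pos_le order_trans)
  qed
  have "bounded ((\<lambda>y. control N \<rho> E e pstar y (Inr b) + dstb t $ Inr b) ` ball x 1)" for b
  proof -
    have "bounded ((\<lambda>y. gain N \<rho> e pstar y i j *\<^sub>R
          (projector (bearing pstar i j) *v sgn_vec (q_vec pstar (positions pstar y) i j))) ` ball x 1)"
      for i j
    proof -
      obtain M where M: "\<And>y. y \<in> ball x 1 \<Longrightarrow> norm (gain N \<rho> e pstar y i j) \<le> M"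
        using compact_bdd[OF continuous_gain] unfolding bounded_iff by blast
      define M' where "M' = onorm ((*v) (projector (bearing pstar i j))) * real CARD('d)"
      have "norm (gain N \<rho> e pstar y i j *\<^sub>R
          (projector (bearing pstar i j) *v sgn_vec (q_vec pstar (positions pstar y) i j))) \<le> M * M'"
        if "y \<in> ball x 1" for y
        unfolding norm_scaleR M'_def
        using M[OF that] sgn_bdd by (intro mult_mono) (auto intro: order_trans[OF abs_ge_zero])
      then show ?thesis unfolding bounded_iff by blast
    qed
    then have "bounded ((\<lambda>y. \<Sum>j\<in>J. gain N \<rho> e pstar y i j *\<^sub>R
          (projector (bearing pstar i j) *v sgn_vec (q_vec pstar (positions pstar y) i j))) ` ball x 1)"
      for i J
      by (induction J rule: infinite_finite_induct) (auto simp: image_constant_conv intro!: bounded_plus_comp)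
    then have "bounded ((\<lambda>y. - control N \<rho> E e pstar y (Inr b)) ` ball x 1)"
      unfolding control_def by simp
    then have "bounded ((\<lambda>y. (- 1) *\<^sub>R - control N \<rho> E e pstar y (Inr b)) ` ball x 1)"
      by (rule bounded_scaleR_comp)
    then show ?thesis by (intro bounded_plus_comp) (auto simp: image_constant_conv)
  qed
  then have "bounded ((\<lambda>y. fst (F t y)) ` ball x 1)"
    unfolding closed_loop_def fst_conv by (rule bdd_vec)
  moreover have "bounded ((\<lambda>y. snd (F t y)) ` ball x 1)"
    unfolding closed_loop_def snd_conv Q_def[symmetric] q_def[symmetric]
    by (intro bdd_vec compact_bdd continuous_intros continuous_Q)
  ultimately have "bounded ((\<lambda>y. fst (F t y)) ` ball x 1 \<times> (\<lambda>y. snd (F t y)) ` ball x 1)"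
    by (rule bounded_Times)
  moreover have "F t ` ball x 1 \<subseteq> (\<lambda>y. fst (F t y)) ` ball x 1 \<times> (\<lambda>y. snd (F t y)) ` ball x 1"
    by (rule image_subsetI) (force simp: mem_Times_iff)
  ultimately show ?thesis by (rule bounded_subset)
qed

text \<open>Two test fields are used in \<open>filippov_map_inner\<close>: the position error,
  padded with \<open>0\<close> in the gains, and the constant unit vector of a single gain.\<close>

lemma filippov_velocity:
  assumes v: "v \<in> filippov_map F t y"
  shows "(fst y - pfol) \<bullet> fst v = - (\<Sum>k\<in>UNIV. \<Sum>s\<in>UNIV. snd y $ s $ k * Q k y ^ (\<rho> s + 1))
      + (fst y - pfol) \<bullet> (\<chi> b. dstb t $ Inr b)"
    and "snd v $ s $ k = Q k y ^ (\<rho> s + 1)"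
proof -
  have "isCont (\<lambda>y. (fst y - pfol, 0 :: (real^'m)^'r)) y"
    by (intro continuous_intros)
  moreover have "isCont (\<lambda>y. (fst y - pfol, 0 :: (real^'m)^'r) \<bullet> F t y) y"
    unfolding inner_prod_def fst_conv snd_conv inner_closed_loop inner_zero_left
    by (intro continuous_intros continuous_Q)
  ultimately have "(fst y - pfol, 0 :: (real^'m)^'r) \<bullet> v = (fst y - pfol, 0 :: (real^'m)^'r) \<bullet> F t y"
    by (rule filippov_map_inner[OF v _ _ zero_less_one bounded_closed_loop])
  then show "(fst y - pfol) \<bullet> fst v = - (\<Sum>k\<in>UNIV. \<Sum>s\<in>UNIV. snd y $ s $ k * Q k y ^ (\<rho> s + 1))
      + (fst y - pfol) \<bullet> (\<chi> b. dstb t $ Inr b)"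
    unfolding inner_prod_def fst_conv snd_conv inner_closed_loop by simp
  define w :: "('d, 'f, 'm, 'r) state" where "w = (0, axis s (axis k 1))"
  have w: "w \<bullet> z = snd z $ s $ k" for z by (simp add: w_def inner_prod_def inner_axis')
  have "isCont (\<lambda>y. w \<bullet> F t y) y"
    unfolding w snd_closed_loop by (intro continuous_intros continuous_Q)
  then have "w \<bullet> v = w \<bullet> F t y"
    by (rule filippov_map_inner[OF v continuous_const _ zero_less_one bounded_closed_loop])
  then show "snd v $ s $ k = Q k y ^ (\<rho> s + 1)" unfolding w snd_closed_loop .
qed

end

subsection \<open>Solutions of the closed loop\<close>

lemma mono_bounded_tendsto_at_top:
  fixes f :: "real \<Rightarrow> real"
  assumes mono: "\<And>s t. a \<le> s \<Longrightarrow> s \<le> t \<Longrightarrow> f s \<le> f t" and bdd: "\<And>t. a \<le> t \<Longrightarrow> f t \<le> B"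
  shows "\<exists>L. (f \<longlongrightarrow> L) at_top"
proof (intro exI order_tendstoI)
  let ?L = "SUP t\<in>{a..}. f t"
  have bddab: "bdd_above (f ` {a..})" using bdd by (intro bdd_aboveI[of _ B]) auto
  have upper: "f t \<le> ?L" if "a \<le> t" for t using that bddab by (intro cSUP_upper) auto
  show "eventually (\<lambda>t. f t < l) at_top" if "?L < l" for l
    by (rule eventually_at_top_linorderI[of a]) (rule le_less_trans[OF upper that])
  show "eventually (\<lambda>t. l < f t) at_top" if "l < ?L" for l
  proof -
    have "\<exists>s\<in>{a..}. l < f s" using that bddab by (subst (asm) less_cSUP_iff) auto
    then obtain s where "a \<le> s" "l < f s" by auto
    then have "l < f t" if "s \<le> t" for t using mono[OF \<open>a \<le> s\<close> that] by linarith
    then show ?thesis by (rule eventually_at_top_linorderI)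
  qed
qed

text \<open>The sum is at most \<open>m\<close> times its largest term. The power of
  \<open>m\<close> enters only the reference gains of \<open>bounded_solution\<close>, not the
  finite-time threshold.\<close>

lemma sum_power_le_card_power:
  fixes f :: "'m::finite \<Rightarrow> real"
  assumes "\<And>k. 0 \<le> f k"
  shows "(\<Sum>k\<in>UNIV. f k) ^ n \<le> real CARD('m) ^ n * (\<Sum>k\<in>UNIV. f k ^ n)"
proof -
  define M where "M = Max (range f)"
  have M: "f k \<le> M" for k unfolding M_def by simp
  have "M \<in> range f" unfolding M_def by (intro Max_in) auto
  then obtain k0 where k0: "M = f k0" by blast
  have "(\<Sum>k\<in>UNIV. f k) \<le> real CARD('m) * M"
    using sum_bounded_above[of UNIV f M] M by simp
  then have "(\<Sum>k\<in>UNIV. f k) ^ n \<le> (real CARD('m) * M) ^ n"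
    using assms by (intro power_mono) (auto simp: sum_nonneg)
  also have "\<dots> = real CARD('m) ^ n * f k0 ^ n" by (simp add: power_mult_distrib k0)
  also have "f k0 ^ n \<le> (\<Sum>k\<in>UNIV. f k ^ n)"
    using assms by (intro member_le_sum) auto
  finally show ?thesis by (simp add: mult_left_mono)
qed

text \<open>\<open>bearing_formation\<close> covers the vector field alone; here a trajectory is
  added, because the disturbance bound refers to the solution.\<close>

locale bearing_tracking = bearing_formation E e pstar dstb N \<rho>
  for E :: "('l::finite + 'f::finite) set set"
    and e :: "'m::finite \<Rightarrow> ('l + 'f) \<times> ('l + 'f)"
    and pstar :: "(real^'d)^('l + 'f)"
    and dstb :: "real \<Rightarrow> (real^'d)^('l + 'f)"
    and N :: nat and \<rho> :: "'r::finite \<Rightarrow> nat" +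
  fixes \<beta> :: "nat \<Rightarrow> real" and x :: "real \<Rightarrow> ('d, 'f, 'm, 'r) state"
  assumes beta_pos: "\<And>r. r \<le> N \<Longrightarrow> 0 < \<beta> r"
    and dstb_bound: "\<And>t. 0 \<le> t \<Longrightarrow> infnorm (dstb t) \<le> (\<Sum>r=0..N. \<beta> r * l1norm (dev (x t)) ^ r)"
    and init: "\<And>r k. r \<le> N \<Longrightarrow> 0 < beta_hat \<rho> (x 0) r $ k"
    and solution: "filippov_solution F x"
begin

text \<open>All that the later arguments use about the derivative of the solution: an upper bound
  for the product with the error and the exact rates of the gains.\<close>

definition velocity :: "real \<Rightarrow> ('d, 'f, 'm, 'r) state \<Rightarrow> bool" where
  "velocity t v \<longleftrightarrow>
    (fst (x t) - pfol) \<bullet> fst v \<le> (\<Sum>s\<in>UNIV. \<beta> (\<rho> s) * l1norm (dev (x t)) ^ (\<rho> s + 1))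
      - (\<Sum>k\<in>UNIV. \<Sum>s\<in>UNIV. snd (x t) $ s $ k * Q k (x t) ^ (\<rho> s + 1))
    \<and> (\<forall>s k. snd v $ s $ k = Q k (x t) ^ (\<rho> s + 1))"

lemma exponent_le: "\<rho> s \<le> N"
  using exponents by (auto simp: bij_betw_def)

lemma exponent_inv: "r \<le> N \<Longrightarrow> \<rho> (inv \<rho> r) = r"
  using exponents by (auto simp: bij_betw_def intro!: f_inv_into_f)

lemma inv_exponent: "inv \<rho> (\<rho> s) = s"
  using exponents by (simp add: bij_betw_def inv_f_f)

lemma beta_nonneg: "0 \<le> \<beta> (\<rho> s)"
  using beta_pos[OF exponent_le] by (rule less_imp_le)

lemma absolutely_continuous_solution: "0 \<le> a \<Longrightarrow> a \<le> b \<Longrightarrow> absolutely_continuous_on {a..b} x"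
  using solution by (auto simp: filippov_solution_def)

text \<open>Hoelder's inequality for the 1-norm and the maximum norm contributes one more factor
  \<open>l1norm (dev (x t))\<close>, which raises each degree from \<open>r\<close> to
  \<open>r + 1\<close>.\<close>

lemma disturbance_work:
  assumes "0 \<le> t"
  shows "(fst (x t) - pfol) \<bullet> (\<chi> b. dstb t $ Inr b)
    \<le> (\<Sum>s\<in>UNIV. \<beta> (\<rho> s) * l1norm (dev (x t)) ^ (\<rho> s + 1))"
proof -
  have "(fst (x t) - pfol) \<bullet> (\<chi> b. dstb t $ Inr b) = dstb t \<bullet> dev (x t)"
    unfolding dev_extend by (simp add: inner_vec_def sum_UNIV_Plus extend_def mult.commute)
  also have "\<dots> \<le> infnorm (dstb t) * l1norm (dev (x t))" by (rule inner_le_infnorm_l1norm)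
  also have "\<dots> \<le> (\<Sum>r=0..N. \<beta> r * l1norm (dev (x t)) ^ r) * l1norm (dev (x t))"
    by (intro mult_right_mono dstb_bound[OF assms] l1norm_nonneg)
  also have "\<dots> = (\<Sum>s\<in>UNIV. \<beta> (\<rho> s) * l1norm (dev (x t)) ^ (\<rho> s + 1))"
    unfolding sum.reindex_bij_betw[OF exponents, symmetric]
    by (simp add: sum_distrib_right mult.assoc mult.commute[of "l1norm _"])
  finally show ?thesis .
qed

text \<open>The differential has to be bounded for every \<open>v\<close> with
  \<open>velocity t v\<close>, so that applications need not mention exceptional times or the
  Filippov map.\<close>

lemma growth:
  assumes ab: "0 \<le> a" "a \<le> b" and lip: "C-lipschitz_on (x ` {a..b}) \<Phi>"
    and der: "\<And>t. t \<in> {a..b} \<Longrightarrow> (\<Phi> has_derivative \<Phi>' (x t)) (at (x t))"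
    and le: "\<And>t v. t \<in> {a..b} \<Longrightarrow> velocity t v \<Longrightarrow> \<Phi>' (x t) v \<le> c"
  shows "\<Phi> (x b) \<le> \<Phi> (x a) + c * (b - a)"
proof (rule growth_along_absolutely_continuous[OF absolutely_continuous_solution[OF ab] ab(2) lip der])
  have "AE t in lebesgue. 0 \<le> t \<longrightarrow>
        (\<exists>v. (x has_vector_derivative v) (at t within {0..}) \<and> v \<in> filippov_map F t (x t))"
    using solution by (simp add: filippov_solution_def)
  then show "AE t in lebesgue. t \<in> {a..b} \<longrightarrow>
      (\<exists>v. (x has_vector_derivative v) (at t within {a..b}) \<and> \<Phi>' (x t) v \<le> c)"
  proof (rule AE_mp, intro AE_I2 impI)
    fix t assume t: "t \<in> {a..b}" and "0 \<le> t \<longrightarrow>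
        (\<exists>v. (x has_vector_derivative v) (at t within {0..}) \<and> v \<in> filippov_map F t (x t))"
    moreover have "0 \<le> t" using t ab by simp
    ultimately obtain v where v: "(x has_vector_derivative v) (at t within {0..})"
        "v \<in> filippov_map F t (x t)" by blast
    have "velocity t v"
      unfolding velocity_def using filippov_velocity[OF v(2)] disturbance_work[OF \<open>0 \<le> t\<close>] by simp
    moreover have "(x has_vector_derivative v) (at t within {a..b})"
      using v(1) by (rule has_vector_derivative_within_subset) (use ab in auto)
    ultimately show "\<exists>v. (x has_vector_derivative v) (at t within {a..b}) \<and> \<Phi>' (x t) v \<le> c"
      using le[OF t] by blast
  qed
qed

lemma bounded_arc: "0 \<le> a \<Longrightarrow> a \<le> b \<Longrightarrow> bounded (x ` {a..b})"
  using absolutely_continuous_on_imp_continuous_on[OF absolutely_continuous_solution]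
  by (intro compact_imp_bounded compact_continuous_image) auto

lemma bounded_linear_gain: "bounded_linear (\<lambda>y :: ('d, 'f, 'm, 'r) state. snd y $ s $ k)"
  by (intro bounded_linear_compose[OF bounded_linear_vec_nth] bounded_linear_snd)

lemma gain_mono:
  assumes "0 \<le> a" "a \<le> b"
  shows "snd (x a) $ s $ k \<le> snd (x b) $ s $ k"
proof -
  \<comment> \<open>\<open>growth\<close> bounds from above, so a lower bound is obtained for the
    negated gain.\<close>
  let ?g = "\<lambda>y :: ('d, 'f, 'm, 'r) state. - (snd y $ s $ k)"
  have lin: "bounded_linear ?g" by (intro bounded_linear_minus bounded_linear_gain)
  then obtain C where C: "C-lipschitz_on (x ` {a..b}) ?g" by (rule bounded_linear.lipschitz_boundE)
  have "?g (x b) \<le> ?g (x a) + 0 * (b - a)"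
    using assms C
  proof (rule growth)
    show "(?g has_derivative ?g) (at (x t))" for t
      using lin by (rule bounded_linear_imp_has_derivative)
    show "- (snd v $ s $ k) \<le> 0" if "velocity t v" for t v
      using that Q_nonneg by (simp add: velocity_def)
  qed
  then show ?thesis by simp
qed

lemma gain_pos: "0 \<le> t \<Longrightarrow> 0 < snd (x t) $ s $ k"
  using init[OF exponent_le, of s k] gain_mono[of 0 t s k] by (simp add: beta_hat_def inv_exponent)

text \<open>The squared error is differentiable at the target too, unlike the norm.\<close>

definition W :: "('d, 'f, 'm, 'r) state \<Rightarrow> real" where
  "W y = (fst y - pfol) \<bullet> (fst y - pfol)"

lemma W_norm: "W y = (norm (dev y))\<^sup>2"
  unfolding W_def norm_dev by (simp add: power2_norm_eq_inner)

lemma W_lipschitz: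
  assumes "bounded S" shows "\<exists>C. C-lipschitz_on S W"
  unfolding W_def
proof (rule lipschitz_on_inner_self)
  show "1-lipschitz_on S (\<lambda>y. fst y - pfol)"
  proof (rule lipschitz_onI)
    show "dist (fst y - pfol) (fst z - pfol) \<le> 1 * dist y z" for y z :: "('d, 'f, 'm, 'r) state"
      using dist_fst_le[of y z] by (simp add: dist_norm)
  qed simp
  show "bounded ((\<lambda>y. fst y - pfol) ` S)"
    using bounded_minus_comp[OF bounded_fst[OF assms], of "\<lambda>_. pfol"] assms
    by (intro bounded_minus_comp) (auto simp: image_constant_conv bounded_fst)
qed

lemma W_derivative: "(W has_derivative (\<lambda>h. 2 * ((fst y - pfol) \<bullet> fst h))) (at y)"
  unfolding W_def by (auto intro!: derivative_eq_intros simp: inner_commute)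

lemma l1norm_dev_power_le:
  "l1norm (dev y) ^ n \<le> (rigidity_const * real CARD('m)) ^ n * (\<Sum>k\<in>UNIV. Q k y ^ n)"
proof -
  have "l1norm (dev y) ^ n \<le> (rigidity_const * (\<Sum>k\<in>UNIV. Q k y)) ^ n"
    by (intro power_mono l1norm_dev_le l1norm_nonneg)
  also have "\<dots> \<le> rigidity_const ^ n * (real CARD('m) ^ n * (\<Sum>k\<in>UNIV. Q k y ^ n))"
    unfolding power_mult_distrib using rigidity_const_pos
    by (intro mult_left_mono sum_power_le_card_power Q_nonneg) simp
  finally show ?thesis by (simp add: power_mult_distrib mult.assoc)
qed

text \<open>The distance to the reference state with gains \<open>\<beta>\<^sub>r (c m)^(r + 1)\<close> is nonincreasing; the
  factor \<open>m^(r + 1)\<close> compensates the passage from \<open>(\<Sum> a)^(r + 1)\<close> to \<open>\<Sum> a^(r + 1)\<close>.\<close>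

lemma bounded_solution: "\<exists>R. \<forall>t\<ge>0. norm (x t) \<le> R"
proof -
  define B where "B s = \<beta> (\<rho> s) * (rigidity_const * real CARD('m)) ^ (\<rho> s + 1)" for s
  define xbar :: "('d, 'f, 'm, 'r) state" where "xbar = (pfol, \<chi> s k. B s)"
  let ?V = "\<lambda>y. (y - xbar) \<bullet> (y - xbar)"
  have le: "?V (x t) \<le> ?V (x 0)" if "0 \<le> t" for t
  proof -
    have "\<exists>C. C-lipschitz_on (x ` {0..t}) ?V"
    proof (rule lipschitz_on_inner_self)
      show "1-lipschitz_on (x ` {0..t}) (\<lambda>y. y - xbar)"
        by (rule lipschitz_onI) (simp_all add: dist_norm)
      show "bounded ((\<lambda>y. y - xbar) ` x ` {0..t})"
        using bounded_arc[OF _ that] by (intro bounded_minus_comp) (auto simp: image_constant_conv)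
    qed
    then obtain C where C: "C-lipschitz_on (x ` {0..t}) ?V" by blast
    have "?V (x t) \<le> ?V (x 0) + 0 * (t - 0)"
      using order_refl that C
    proof (rule growth)
      show "(?V has_derivative (\<lambda>h. 2 * ((x s - xbar) \<bullet> h))) (at (x s))" for s
        by (auto intro!: derivative_eq_intros simp: inner_commute)
      show "2 * ((x s - xbar) \<bullet> v) \<le> 0" if v: "velocity s v" for s v
      proof -
        have "(\<Sum>r\<in>UNIV. \<beta> (\<rho> r) * l1norm (dev (x s)) ^ (\<rho> r + 1))
            \<le> (\<Sum>r\<in>UNIV. \<Sum>k\<in>UNIV. B r * Q k (x s) ^ (\<rho> r + 1))"
        proof (rule sum_mono)
          fix r
          have "\<beta> (\<rho> r) * l1norm (dev (x s)) ^ (\<rho> r + 1) \<le> \<beta> (\<rho> r) *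
              ((rigidity_const * real CARD('m)) ^ (\<rho> r + 1) * (\<Sum>k\<in>UNIV. Q k (x s) ^ (\<rho> r + 1)))"
            by (intro mult_left_mono l1norm_dev_power_le beta_nonneg)
          then show "\<beta> (\<rho> r) * l1norm (dev (x s)) ^ (\<rho> r + 1) \<le> (\<Sum>k\<in>UNIV. B r * Q k (x s) ^ (\<rho> r + 1))"
            by (simp only: B_def sum_distrib_left mult.assoc)
        qed
        moreover have "(x s - xbar) \<bullet> v = (fst (x s) - pfol) \<bullet> fst v
            + (\<Sum>r\<in>UNIV. \<Sum>k\<in>UNIV. (snd (x s) $ r $ k - B r) * Q k (x s) ^ (\<rho> r + 1))"
          using v by (simp add: xbar_def inner_prod_def velocity_def
              inner_vec_def[of "snd (x s) - _"] inner_vec_def[of "snd (x s) $ _ - _"])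
        \<comment> \<open>The first part cancels the work of the control exactly; the reference part
          left over dominates the disturbance.\<close>
        moreover have "(\<Sum>r\<in>UNIV. \<Sum>k\<in>UNIV. (snd (x s) $ r $ k - B r) * Q k (x s) ^ (\<rho> r + 1))
            = (\<Sum>k\<in>UNIV. \<Sum>r\<in>UNIV. snd (x s) $ r $ k * Q k (x s) ^ (\<rho> r + 1))
              - (\<Sum>r\<in>UNIV. \<Sum>k\<in>UNIV. B r * Q k (x s) ^ (\<rho> r + 1))"
          unfolding left_diff_distrib sum_subtractf by (subst sum.swap) simp
        moreover have "(fst (x s) - pfol) \<bullet> fst v \<le> (\<Sum>r\<in>UNIV. \<beta> (\<rho> r) * l1norm (dev (x s)) ^ (\<rho> r + 1))
            - (\<Sum>k\<in>UNIV. \<Sum>r\<in>UNIV. snd (x s) $ r $ k * Q k (x s) ^ (\<rho> r + 1))"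
          using v by (simp add: velocity_def)
        ultimately show ?thesis by linarith
      qed
    qed
    then show ?thesis by simp
  qed
  have "norm (x t) \<le> norm (x 0 - xbar) + norm xbar" if "0 \<le> t" for t
  proof -
    have "norm (x t - xbar) \<le> norm (x 0 - xbar)"
      using le[OF that] by (simp add: norm_eq_sqrt_inner)
    then show ?thesis using norm_triangle_ineq2[of "x t" xbar] by linarith
  qed
  then show ?thesis by blast
qed

section \<open>Limits of the gains and of the formation\<close>

lemma gain_converges: "\<exists>b. ((\<lambda>t. snd (x t) $ s $ k) \<longlongrightarrow> b) at_top"
proof -
  obtain R where R: "\<And>t. 0 \<le> t \<Longrightarrow> norm (x t) \<le> R" using bounded_solution by blast
  show ?thesis
  proof (rule mono_bounded_tendsto_at_top[of 0 _ R])
    show "snd (x t) $ s $ k \<le> R" if "0 \<le> t" for t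
    proof -
      have "snd (x t) $ s $ k \<le> norm (snd (x t) $ s)"
        using component_le_norm_cart[of "snd (x t) $ s" k] by linarith
      also have "\<dots> \<le> norm (snd (x t))" by (rule Finite_Cartesian_Product.norm_nth_le)
      also have "\<dots> \<le> norm (x t)" using norm_snd_le[of "snd (x t)" "fst (x t)"] by simp
      finally show ?thesis using R[OF that] by simp
    qed
  qed (rule gain_mono)
qed

lemma bounded_l1norm_dev: "\<exists>L. \<forall>t\<ge>0. l1norm (dev (x t)) \<le> L"
proof -
  obtain R where R: "\<And>t. 0 \<le> t \<Longrightarrow> norm (x t) \<le> R" using bounded_solution by blast
  let ?D = "real DIM((real^'d)^('l + 'f))"
  have "l1norm (dev (x t)) \<le> sqrt ?D * (R + norm pfol)" if "0 \<le> t" for t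
  proof -
    have "norm (dev (x t)) \<le> norm (fst (x t)) + norm pfol"
      unfolding norm_dev by (rule norm_triangle_ineq4)
    also have "\<dots> \<le> R + norm pfol" using R[OF that] norm_fst_le[of "fst (x t)" "snd (x t)"] by simp
    finally have "sqrt ?D * norm (dev (x t)) \<le> sqrt ?D * (R + norm pfol)"
      by (rule mult_left_mono) simp
    then show ?thesis using l1norm_le_norm[of "dev (x t)"] by linarith
  qed
  then show ?thesis by blast
qed

text \<open>Up to an additive constant, the time integral of the sum of all \<open>Q k\<close>,
  which by \<open>l1norm_dev_le\<close> controls the error.\<close>

definition total_gain :: "('d, 'f, 'm, 'r) state \<Rightarrow> real" where
  "total_gain y = (\<Sum>k\<in>UNIV. snd y $ inv \<rho> 0 $ k)"

lemma bounded_linear_total_gain: "bounded_linear total_gain"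
  unfolding total_gain_def by (intro bounded_linear_sum bounded_linear_gain)

lemma total_gain_velocity: "velocity t v \<Longrightarrow> total_gain v = (\<Sum>k\<in>UNIV. Q k (x t))"
  by (simp add: total_gain_def velocity_def exponent_inv)

text \<open>In place of Barbalat's lemma: the growth of \<open>W\<close> is at most \<open>K\<close> times that of \<open>total_gain\<close>, so \<open>W - K total_gain\<close> and
  hence \<open>W\<close> converges; as long as \<open>W\<close> stays away from \<open>0\<close>, the bounded quantity \<open>total_gain\<close> would grow linearly.\<close>

lemma W_tendsto_zero: "((\<lambda>t. W (x t)) \<longlongrightarrow> 0) at_top"
proof -
  obtain L where L: "\<And>t. 0 \<le> t \<Longrightarrow> l1norm (dev (x t)) \<le> L" using bounded_l1norm_dev by blast
  \<comment> \<open>\<open>M\<close> bounds the work of the disturbance per unit of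
    \<open>l1norm (dev (x t))\<close> as long as that norm is at most \<open>L\<close>. In
    \<open>K\<close>, the \<open>2\<close> comes from the derivative of \<open>W\<close> and
    \<open>rigidity_const\<close> from the passage to the sum of the \<open>Q k\<close>.\<close>
  define M where "M = (\<Sum>s\<in>UNIV. \<beta> (\<rho> s) * L ^ \<rho> s)"
  define K where "K = 2 * (M * rigidity_const)"
  have "0 \<le> L" using L[of 0] l1norm_nonneg order_trans by blast
  then have "0 \<le> M" unfolding M_def by (intro sum_nonneg mult_nonneg_nonneg beta_nonneg) simp
  then have "0 \<le> K" using rigidity_const_pos by (simp add: K_def)
  have vel: "2 * ((fst (x t) - pfol) \<bullet> fst v) \<le> K * total_gain v" if "0 \<le> t" and v: "velocity t v" for t v
  proof -
    \<comment> \<open>The gains stay positive, so the control only lowers \<open>W\<close> and may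
      be dropped from this upper bound.\<close>
    have "0 \<le> (\<Sum>k\<in>UNIV. \<Sum>s\<in>UNIV. snd (x t) $ s $ k * Q k (x t) ^ (\<rho> s + 1))"
      using gain_pos[OF that(1)]
      by (intro sum_nonneg mult_nonneg_nonneg zero_le_power Q_nonneg) (simp add: less_imp_le)
    then have "(fst (x t) - pfol) \<bullet> fst v \<le> (\<Sum>s\<in>UNIV. \<beta> (\<rho> s) * l1norm (dev (x t)) ^ (\<rho> s + 1))"
      using v by (simp add: velocity_def)
    also have "\<dots> \<le> (\<Sum>s\<in>UNIV. (\<beta> (\<rho> s) * L ^ \<rho> s) * l1norm (dev (x t)))"
    proof (rule sum_mono)
      fix s
      have "l1norm (dev (x t)) ^ \<rho> s \<le> L ^ \<rho> s"
        by (intro power_mono L[OF that(1)] l1norm_nonneg)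
      then have "\<beta> (\<rho> s) * l1norm (dev (x t)) ^ \<rho> s * l1norm (dev (x t)) \<le> \<beta> (\<rho> s) * L ^ \<rho> s * l1norm (dev (x t))"
        by (intro mult_right_mono mult_left_mono l1norm_nonneg beta_nonneg)
      then show "\<beta> (\<rho> s) * l1norm (dev (x t)) ^ (\<rho> s + 1) \<le> \<beta> (\<rho> s) * L ^ \<rho> s * l1norm (dev (x t))"
        by (simp only: power_add power_one_right mult.assoc)
    qed
    also have "\<dots> = M * l1norm (dev (x t))" by (simp only: M_def sum_distrib_right)
    also have "\<dots> \<le> M * (rigidity_const * total_gain v)"
      unfolding total_gain_velocity[OF v] using \<open>0 \<le> M\<close> by (intro mult_left_mono l1norm_dev_le)
    finally show ?thesis by (simp add: K_def)
  qed
  have mono: "K * total_gain (x a) - W (x a) \<le> K * total_gain (x b) - W (x b)" if ab: "0 \<le> a" "a \<le> b" for a b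
  proof -
    let ?g = "\<lambda>y. W y + - K * total_gain y"
    have lin: "bounded_linear (\<lambda>y. - K * total_gain y)"
      by (intro bounded_linear_const_mult bounded_linear_total_gain)
    obtain C1 where "C1-lipschitz_on (x ` {a..b}) W" using W_lipschitz[OF bounded_arc[OF ab]] by blast
    moreover obtain C2 where "C2-lipschitz_on (x ` {a..b}) (\<lambda>y. - K * total_gain y)"
      using lin by (rule bounded_linear.lipschitz_boundE)
    ultimately have "(C1 + C2)-lipschitz_on (x ` {a..b}) ?g" by (rule lipschitz_on_add)
    with ab have "?g (x b) \<le> ?g (x a) + 0 * (b - a)"
    proof (rule growth)
      show "(?g has_derivative (\<lambda>h. 2 * ((fst (x t) - pfol) \<bullet> fst h) + - K * total_gain h)) (at (x t))" for t
        by (intro has_derivative_add W_derivative bounded_linear_imp_has_derivative[OF lin])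
      show "2 * ((fst (x t) - pfol) \<bullet> fst v) + - K * total_gain v \<le> 0"
        if "t \<in> {a..b}" "velocity t v" for t v
        using vel[OF _ that(2)] that(1) ab by simp
    qed
    then show ?thesis by simp
  qed
  have "\<forall>k. \<exists>b. ((\<lambda>t. snd (x t) $ inv \<rho> 0 $ k) \<longlongrightarrow> b) at_top" using gain_converges by blast
  then obtain b where "\<And>k. ((\<lambda>t. snd (x t) $ inv \<rho> 0 $ k) \<longlongrightarrow> b k) at_top" by metis
  then have Glim: "((\<lambda>t. total_gain (x t)) \<longlongrightarrow> (\<Sum>k\<in>UNIV. b k)) at_top"
    unfolding total_gain_def by (intro tendsto_sum)
  have Gmono: "total_gain (x a) \<le> total_gain (x b)" if "0 \<le> a" "a \<le> b" for a b
    unfolding total_gain_def by (intro sum_mono gain_mono that)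
  define Gmax where "Gmax = (\<Sum>k\<in>UNIV. b k)"
  have Gmax: "total_gain (x t) \<le> Gmax" if "0 \<le> t" for t
    using Glim unfolding Gmax_def
    by (rule tendsto_lowerbound) (auto intro!: eventually_at_top_linorderI[of t] Gmono that)
  have "\<exists>l. ((\<lambda>t. K * total_gain (x t) - W (x t)) \<longlongrightarrow> l) at_top"
  proof (rule mono_bounded_tendsto_at_top[OF mono])
    show "K * total_gain (x t) - W (x t) \<le> K * Gmax" if "0 \<le> t" for t
      using mult_left_mono[OF Gmax[OF that] \<open>0 \<le> K\<close>] by (simp add: W_norm add_increasing2 algebra_simps)
  qed
  then obtain l where "((\<lambda>t. K * total_gain (x t) - W (x t)) \<longlongrightarrow> l) at_top" by blast
  then have "((\<lambda>t. K * total_gain (x t) - (K * total_gain (x t) - W (x t))) \<longlongrightarrow> K * Gmax - l) at_top"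
    using Glim unfolding Gmax_def by (intro tendsto_diff tendsto_mult tendsto_const)
  then have lim: "((\<lambda>t. W (x t)) \<longlongrightarrow> K * Gmax - l) at_top" by simp
  have "0 \<le> K * Gmax - l" using lim by (rule tendsto_lowerbound) (auto simp: W_norm)
  moreover have "\<not> 0 < K * Gmax - l"
  proof
    define w where "w = K * Gmax - l"
    assume "0 < K * Gmax - l"
    then have "0 < w" by (simp add: w_def)
    then have "w / 2 < w" by simp
    with lim[folded w_def] have "eventually (\<lambda>t. w / 2 < W (x t)) at_top" by (rule order_tendstoD(1))
    then obtain T0 where T0: "\<And>t. T0 \<le> t \<Longrightarrow> w / 2 < W (x t)"
      unfolding eventually_at_top_linorder by blast
    define T where "T = max T0 0"
    have T: "0 \<le> T" "\<And>t. T \<le> t \<Longrightarrow> w / 2 < W (x t)" using T0 by (auto simp: T_def)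
    define \<eta> where "\<eta> = sqrt (w / 2) / rigidity_const"
    have "0 < \<eta>" using \<open>0 < w\<close> rigidity_const_pos by (simp add: \<eta>_def)
    have low: "\<eta> \<le> total_gain v" if "T \<le> t" "velocity t v" for t v
    proof -
      have "sqrt (w / 2) \<le> sqrt (W (x t))" using T(2)[OF that(1)] by (intro real_sqrt_le_mono) simp
      also have "\<dots> = norm (dev (x t))" by (simp add: W_norm)
      also have "\<dots> \<le> rigidity_const * total_gain v"
        unfolding total_gain_velocity[OF that(2)] using norm_le_l1norm l1norm_dev_le by (rule order_trans)
      finally show ?thesis using rigidity_const_pos by (simp add: \<eta>_def field_simps)
    qed
    \<comment> \<open>With slope at least \<open>\<eta>\<close>, \<open>total_gain\<close> exceeds
      its supremum bound \<open>Gmax\<close> by \<open>1\<close> at this time.\<close>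
    define b where "b = T + (Gmax - total_gain (x T) + 1) / \<eta>"
    have "T \<le> b" using Gmax[OF T(1)] \<open>0 < \<eta>\<close> by (simp add: b_def)
    let ?g = "\<lambda>y. - total_gain y"
    have lin: "bounded_linear ?g" by (intro bounded_linear_minus bounded_linear_total_gain)
    then obtain C where C: "C-lipschitz_on (x ` {T..b}) ?g" by (rule bounded_linear.lipschitz_boundE)
    have "?g (x b) \<le> ?g (x T) + (- \<eta>) * (b - T)"
      using T(1) \<open>T \<le> b\<close> C
    proof (rule growth)
      show "(?g has_derivative ?g) (at (x t))" for t
        using lin by (rule bounded_linear_imp_has_derivative)
      show "- total_gain v \<le> - \<eta>" if "t \<in> {T..b}" "velocity t v" for t v
        using low[of t v] that by simp
    qed
    moreover have "(- \<eta>) * (b - T) = - (Gmax - total_gain (x T) + 1)"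
      using \<open>0 < \<eta>\<close> by (simp add: b_def)
    ultimately show False using Gmax[of b] T(1) \<open>T \<le> b\<close> by simp
  qed
  ultimately show ?thesis using lim by simp
qed

lemma norm_dev_tendsto_zero: "((\<lambda>t. norm (dev (x t))) \<longlongrightarrow> 0) at_top"
  using tendsto_real_sqrt[OF W_tendsto_zero] by (simp add: W_norm)

lemma positions_tendsto: "((\<lambda>t. positions pstar (x t)) \<longlongrightarrow> pstar) at_top"
  by (rule LIM_zero_cancel[OF tendsto_norm_zero_cancel[OF norm_dev_tendsto_zero]])

text \<open>Near the target the terms of order \<open>r \<ge> 1\<close> are dominated by the margin left at \<open>r = 0\<close>.\<close>

lemma eventual_decrease:
  assumes T: "0 \<le> T" and b: "\<beta> 0 * rigidity_const < b" and gain: "\<And>k. b < snd (x T) $ inv \<rho> 0 $ k"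
  shows "\<exists>\<kappa>>0. \<exists>T'\<ge>T. \<forall>t\<ge>T'. \<forall>v. velocity t v \<longrightarrow>
    (fst (x t) - pfol) \<bullet> fst v \<le> - \<kappa> * norm (dev (x t))"
proof -
  let ?s0 = "inv \<rho> 0"
  have s0: "\<rho> ?s0 = 0" by (simp add: exponent_inv)
  \<comment> \<open>Half of the margin by which the gains of order \<open>0\<close> beat the
    disturbance; the other half absorbs the terms of higher order.\<close>
  define \<kappa> where "\<kappa> = (b / rigidity_const - \<beta> 0) / 2"
  have "0 < \<kappa>" using b rigidity_const_pos by (simp add: \<kappa>_def field_simps)
  have "0 < b" using b rigidity_const_pos beta_pos[of 0] by (smt (verit) mult_pos_pos zero_le)
  define K where "K = (\<Sum>s\<in>UNIV - {?s0}. \<beta> (\<rho> s))"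
  have "0 \<le> K" unfolding K_def by (intro sum_nonneg beta_nonneg)
  define D where "D = sqrt (real DIM((real^'d)^('l + 'f)))"
  have "((\<lambda>t. D * norm (dev (x t))) \<longlongrightarrow> D * 0) at_top"
    by (intro tendsto_mult tendsto_const norm_dev_tendsto_zero)
  \<comment> \<open>The bound \<open>1\<close> makes every power \<open>ell ^ (r + 1)\<close> with
    \<open>r \<ge> 1\<close> at most \<open>ell\<^sup>2\<close>; the bound
    \<open>\<kappa> / (K + 1)\<close> then makes their total at most
    \<open>\<kappa> * ell\<close>.\<close>
  moreover have "D * 0 < min 1 (\<kappa> / (K + 1))" using \<open>0 < \<kappa>\<close> \<open>0 \<le> K\<close> by simp
  ultimately have "eventually (\<lambda>t. D * norm (dev (x t)) < min 1 (\<kappa> / (K + 1))) at_top"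
    by (rule order_tendstoD(2))
  then obtain T0 where T0: "\<And>t. T0 \<le> t \<Longrightarrow> D * norm (dev (x t)) < min 1 (\<kappa> / (K + 1))"
    unfolding eventually_at_top_linorder by blast
  have "(fst (x t) - pfol) \<bullet> fst v \<le> - \<kappa> * norm (dev (x t))"
    if t: "max T T0 \<le> t" and v: "velocity t v" for t v
  proof -
    define ell where "ell = l1norm (dev (x t))"
    have ell: "0 \<le> ell" "ell \<le> 1" "ell \<le> \<kappa> / (K + 1)"
      using T0[of t] t l1norm_le_norm[of "dev (x t)"] l1norm_nonneg[of "dev (x t)"]
      by (auto simp: ell_def D_def)
    have "0 \<le> t" using t T by simp
    have gains: "0 \<le> snd (x t) $ s $ k" for s k using gain_pos[OF \<open>0 \<le> t\<close>] by (rule less_imp_le)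
    have "(\<Sum>k\<in>UNIV. b * Q k (x t)) \<le> (\<Sum>k\<in>UNIV. \<Sum>s\<in>UNIV. snd (x t) $ s $ k * Q k (x t) ^ (\<rho> s + 1))"
    proof (rule sum_mono)
      fix k
      have "b \<le> snd (x t) $ ?s0 $ k"
        using gain[of k] gain_mono[of T t ?s0 k] T t by simp
      then have "b * Q k (x t) \<le> snd (x t) $ ?s0 $ k * Q k (x t) ^ (\<rho> ?s0 + 1)"
        using Q_nonneg by (simp add: s0 mult_right_mono)
      also have "\<dots> \<le> (\<Sum>s\<in>UNIV. snd (x t) $ s $ k * Q k (x t) ^ (\<rho> s + 1))"
        using gains Q_nonneg by (intro member_le_sum[of ?s0 UNIV "\<lambda>s. snd (x t) $ s $ k * Q k (x t) ^ (\<rho> s + 1)"]) auto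
      finally show "b * Q k (x t) \<le> (\<Sum>s\<in>UNIV. snd (x t) $ s $ k * Q k (x t) ^ (\<rho> s + 1))" .
    qed
    moreover have "b / rigidity_const * ell \<le> (\<Sum>k\<in>UNIV. b * Q k (x t))"
    proof -
      have "b / rigidity_const * ell \<le> b / rigidity_const * (rigidity_const * (\<Sum>k\<in>UNIV. Q k (x t)))"
        unfolding ell_def using \<open>0 < b\<close> rigidity_const_pos by (intro mult_left_mono l1norm_dev_le) simp
      then show ?thesis using rigidity_const_pos by (simp add: sum_distrib_left)
    qed
    moreover have "(\<Sum>s\<in>UNIV. \<beta> (\<rho> s) * ell ^ (\<rho> s + 1)) \<le> \<beta> 0 * ell + K * (ell * ell)"
    proof -
      have "(\<Sum>s\<in>UNIV. \<beta> (\<rho> s) * ell ^ (\<rho> s + 1))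
          = \<beta> 0 * ell + (\<Sum>s\<in>UNIV - {?s0}. \<beta> (\<rho> s) * ell ^ (\<rho> s + 1))"
        by (subst sum.remove[of _ ?s0]) (auto simp: s0)
      moreover have "(\<Sum>s\<in>UNIV - {?s0}. \<beta> (\<rho> s) * ell ^ (\<rho> s + 1)) \<le> (\<Sum>s\<in>UNIV - {?s0}. \<beta> (\<rho> s) * (ell * ell))"
      proof (rule sum_mono)
        fix s assume "s \<in> UNIV - {?s0}"
        then have "\<rho> s \<noteq> 0" using inv_exponent by (metis DiffD2 singletonI)
        then have "2 \<le> \<rho> s + 1" by simp
        then have "ell ^ (\<rho> s + 1) \<le> ell ^ 2" using ell by (intro power_decreasing)
        then show "\<beta> (\<rho> s) * ell ^ (\<rho> s + 1) \<le> \<beta> (\<rho> s) * (ell * ell)"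
          unfolding power2_eq_square by (intro mult_left_mono beta_nonneg)
      qed
      ultimately show ?thesis by (simp add: K_def sum_distrib_right)
    qed
    moreover have "K * (ell * ell) \<le> \<kappa> * ell"
    proof -
      have "(K + 1) * ell \<le> \<kappa>" using ell(3) \<open>0 \<le> K\<close> by (simp add: field_simps)
      then have "K * ell \<le> \<kappa>" using ell(1) by (simp add: distrib_right)
      then show ?thesis using ell(1) by (simp add: mult_right_mono flip: mult.assoc)
    qed
    moreover have "(fst (x t) - pfol) \<bullet> fst v \<le> (\<Sum>s\<in>UNIV. \<beta> (\<rho> s) * ell ^ (\<rho> s + 1))
        - (\<Sum>k\<in>UNIV. \<Sum>s\<in>UNIV. snd (x t) $ s $ k * Q k (x t) ^ (\<rho> s + 1))"
      using v by (simp add: velocity_def ell_def)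
    moreover have "\<beta> 0 * ell + \<kappa> * ell - b / rigidity_const * ell = - \<kappa> * ell"
      by (simp add: \<kappa>_def field_simps)
    ultimately have "(fst (x t) - pfol) \<bullet> fst v \<le> - \<kappa> * ell" by linarith
    also have "\<dots> \<le> - \<kappa> * norm (dev (x t))"
      using norm_le_l1norm[of "dev (x t)"] \<open>0 < \<kappa>\<close> by (simp add: ell_def)
    finally show ?thesis .
  qed
  moreover have "T \<le> max T T0" by simp
  ultimately show ?thesis using \<open>0 < \<kappa>\<close> by blast
qed

text \<open>The norm falls at a uniform rate but is not differentiable at the target, whereas the
  rate of \<open>W\<close> degenerates there. So \<open>W\<close> shows that the target is never
  left again, and that a nonzero final error was nonzero before; the norm then gives the arrival
  time.\<close>

lemma finite_time:
  assumes "0 \<le> T" "\<beta> 0 * rigidity_const < b" "\<And>k. b < snd (x T) $ inv \<rho> 0 $ k"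
  shows "\<exists>T'\<ge>0. \<forall>t\<ge>T'. positions pstar (x t) = pstar"
proof -
  obtain \<kappa> S where "0 < \<kappa>" "T \<le> S" and S: "\<And>t v. S \<le> t \<Longrightarrow> velocity t v \<Longrightarrow>
      (fst (x t) - pfol) \<bullet> fst v \<le> - \<kappa> * norm (dev (x t))"
    using eventual_decrease[OF assms] by blast
  have "0 \<le> S" using \<open>T \<le> S\<close> assms(1) by simp
  have antimono: "W (x c) \<le> W (x a)" if ac: "S \<le> a" "a \<le> c" for a c
  proof -
    have "0 \<le> a" using ac \<open>0 \<le> S\<close> by simp
    obtain C where "C-lipschitz_on (x ` {a..c}) W"
      using W_lipschitz[OF bounded_arc[OF \<open>0 \<le> a\<close> ac(2)]] by blast
    with \<open>0 \<le> a\<close> ac(2) have "W (x c) \<le> W (x a) + 0 * (c - a)"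
    proof (rule growth)
      show "(W has_derivative (\<lambda>h. 2 * ((fst (x t) - pfol) \<bullet> fst h))) (at (x t))" for t
        by (rule W_derivative)
      show "2 * ((fst (x t) - pfol) \<bullet> fst v) \<le> 0" if "t \<in> {a..c}" "velocity t v" for t v
      proof -
        have "(fst (x t) - pfol) \<bullet> fst v \<le> - \<kappa> * norm (dev (x t))" using S[of t v] that ac by simp
        also have "\<dots> \<le> 0" using \<open>0 < \<kappa>\<close> by simp
        finally show ?thesis by simp
      qed
    qed
    then show ?thesis by simp
  qed
  \<comment> \<open>The extra \<open>1\<close> makes the bound for the norm at \<open>T'\<close>
    equal to \<open>-1\<close>, a contradiction if the target has not been reached.\<close>
  define T' where "T' = S + (norm (dev (x S)) + 1) / \<kappa>"
  have "S \<le> T'" using \<open>0 < \<kappa>\<close> by (simp add: T'_def)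
  have "dev (x T') = 0"
  proof (rule ccontr)
    assume nz: "dev (x T') \<noteq> 0"
    have pos: "fst (x t) - pfol \<noteq> 0" if "t \<in> {S..T'}" for t
    proof -
      have "0 < W (x T')" using nz by (simp add: W_norm)
      also have "\<dots> \<le> W (x t)" using antimono[of t T'] that by simp
      finally show ?thesis by (auto simp: W_def)
    qed
    let ?g = "\<lambda>y :: ('d, 'f, 'm, 'r) state. norm (fst y - pfol)"
    have "1-lipschitz_on (x ` {S..T'}) ?g"
    proof (rule lipschitz_onI)
      show "dist (?g y) (?g z) \<le> 1 * dist y z" for y z :: "('d, 'f, 'm, 'r) state"
        using norm_triangle_ineq3[of "fst y - pfol" "fst z - pfol"] dist_fst_le[of y z]
        by (simp add: dist_norm)
    qed simp
    with \<open>0 \<le> S\<close> \<open>S \<le> T'\<close> have "?g (x T') \<le> ?g (x S) + (- \<kappa>) * (T' - S)"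
    proof (rule growth)
      \<comment> \<open>Here \<open>sgn\<close> normalises the whole vector and is the gradient of
        the norm, not the componentwise sign of the controller.\<close>
      show "(?g has_derivative (\<lambda>h. fst h \<bullet> sgn (fst (x t) - pfol))) (at (x t))" if "t \<in> {S..T'}" for t
      proof -
        have "((\<lambda>y :: ('d, 'f, 'm, 'r) state. fst y - pfol) has_derivative fst) (at (x t))"
          by (auto intro!: derivative_eq_intros)
        from has_derivative_compose[OF this has_derivative_norm[OF pos[OF that]]]
        show ?thesis by (simp add: inner_commute)
      qed
      show "fst v \<bullet> sgn (fst (x t) - pfol) \<le> - \<kappa>" if t: "t \<in> {S..T'}" and v: "velocity t v" for t v
      proof -
        have n: "0 < norm (fst (x t) - pfol)" using pos[OF t] by simp
        have "(fst (x t) - pfol) \<bullet> fst v \<le> - \<kappa> * norm (fst (x t) - pfol)"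
          using S[OF _ v] t by (simp add: norm_dev)
        then have "((fst (x t) - pfol) \<bullet> fst v) / norm (fst (x t) - pfol) \<le> - \<kappa>"
          using n by (simp add: pos_divide_le_eq)
        then show ?thesis
          by (simp add: sgn_div_norm inner_commute[of "fst v"] divide_inverse mult.commute)
      qed
    qed
    moreover have "(- \<kappa>) * (T' - S) = - (?g (x S) + 1)"
      using \<open>0 < \<kappa>\<close> by (simp add: T'_def norm_dev)
    ultimately have "?g (x T') \<le> - 1" by simp
    moreover have "0 \<le> ?g (x T')" by simp
    ultimately show False by linarith
  qed
  then have "W (x T') = 0" by (simp add: W_norm)
  have "positions pstar (x t) = pstar" if "T' \<le> t" for t
  proof -
    have "W (x t) \<le> 0" using antimono[of T' t] that \<open>S \<le> T'\<close> \<open>W (x T') = 0\<close> by simp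
    then show ?thesis by (simp add: W_norm)
  qed
  moreover have "0 \<le> T'" using \<open>0 \<le> S\<close> \<open>S \<le> T'\<close> by simp
  ultimately show ?thesis by blast
qed

end

theorem mainTheorem5:
  fixes E :: "('l::finite + 'f::finite) set set"
    and e :: "'m::finite \<Rightarrow> ('l + 'f) \<times> ('l + 'f)"
    and pstar :: "(real^'d)^('l + 'f)"
    and dstb :: "real \<Rightarrow> (real^'d)^('l + 'f)"
    and N :: nat and \<rho> :: "'r::finite \<Rightarrow> nat"
    and \<beta> :: "nat \<Rightarrow> real"
    and x :: "real \<Rightarrow> ('d, 'f, 'm, 'r) state"
  assumes dim: "2 \<le> CARD('d)"
    and leaders: "2 \<le> CARD('l)"
    and graph: "simple_graph E" "oriented_edges E e"
    and target: "inj (\<lambda>i. pstar $ i)" "infinitesimally_bearing_rigid e pstar"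
    and exponents: "1 \<le> N" "bij_betw \<rho> UNIV {0..N}"
    and beta_pos: "\<forall>r\<le>N. 0 < \<beta> r"
    and dstb_ucont: "uniformly_continuous_on {0..} dstb"
    and dstb_bound: "\<forall>t\<ge>0. infnorm (dstb t) \<le>
          (\<Sum>r=0..N. \<beta> r * l1norm (positions pstar (x t) - pstar) ^ r)"
    and init: "\<forall>r\<le>N. \<forall>k. 0 < beta_hat \<rho> (x 0) r $ k"
    and solution: "filippov_solution (closed_loop N \<rho> E e pstar dstb) x"
    and no_collision: "\<forall>t\<ge>0. \<forall>i j. i \<noteq> j \<longrightarrow>
          positions pstar (x t) $ i \<noteq> positions pstar (x t) $ j"
  shows "bounded ((\<lambda>t. positions pstar (x t) - pstar) ` {0..})
    \<and> (\<forall>r\<le>N. bounded ((\<lambda>t. beta_hat \<rho> (x t) r) ` {0..}))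
    \<and> ((\<lambda>t. positions pstar (x t)) \<longlongrightarrow> pstar) at_top
    \<and> (\<forall>r\<le>N. \<exists>b. ((\<lambda>t. beta_hat \<rho> (x t) r) \<longlongrightarrow> b) at_top)
    \<and> (\<forall>\<beta>bar T.
          (\<forall>r\<le>N. \<beta>bar r > \<beta> r *
             sqrt (real (CARD('d) * CARD('l + 'f))
                   / lambda_min (follower_block (bearing_laplacian e pstar))) ^ (r + 1))
          \<and> 0 \<le> T
          \<and> (\<forall>r\<le>N. \<forall>k. beta_hat \<rho> (x T) r $ k > \<beta>bar r)
          \<longrightarrow> (\<exists>T'\<ge>0. \<forall>t\<ge>T'. positions pstar (x t) = pstar))"
proof -
  interpret bearing_tracking E e pstar dstb N \<rho> \<beta> x
    using leaders graph target exponents beta_pos dstb_bound init solution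
    by unfold_locales auto
  obtain R where R: "\<And>t. 0 \<le> t \<Longrightarrow> norm (x t) \<le> R" using bounded_solution by blast
  obtain L where L: "\<And>t. 0 \<le> t \<Longrightarrow> l1norm (dev (x t)) \<le> L" using bounded_l1norm_dev by blast
  show ?thesis
  proof (intro conjI allI impI)
    show "bounded ((\<lambda>t. dev (x t)) ` {0..})"
      using L norm_le_l1norm order_trans by (intro boundedI[of _ L]) blast
    show "bounded ((\<lambda>t. beta_hat \<rho> (x t) r) ` {0..})" for r
    proof -
      have "norm (beta_hat \<rho> (x t) r) \<le> R" if "0 \<le> t" for t
        unfolding beta_hat_def
        using Finite_Cartesian_Product.norm_nth_le[of "snd (x t)" "inv \<rho> r"] norm_snd_le[of "snd (x t)" "fst (x t)"] R[OF that]
        by simp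
      then show ?thesis by (intro boundedI[of _ R]) auto
    qed
    show "((\<lambda>t. positions pstar (x t)) \<longlongrightarrow> pstar) at_top" by (rule positions_tendsto)
    show "\<exists>b. ((\<lambda>t. beta_hat \<rho> (x t) r) \<longlongrightarrow> b) at_top" for r
    proof -
      have "\<forall>k. \<exists>b. ((\<lambda>t. snd (x t) $ inv \<rho> r $ k) \<longlongrightarrow> b) at_top" using gain_converges by blast
      then obtain b where b: "\<And>k. ((\<lambda>t. snd (x t) $ inv \<rho> r $ k) \<longlongrightarrow> b k) at_top" by metis
      have "((\<lambda>t. beta_hat \<rho> (x t) r) \<longlongrightarrow> (\<chi> k. b k)) at_top"
        unfolding beta_hat_def by (rule vec_tendstoI) (simp add: b)
      then show ?thesis by blast
    qed
    show "\<exists>T'\<ge>0. \<forall>t\<ge>T'. positions pstar (x t) = pstar"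
      if *: "(\<forall>r\<le>N. \<beta>bar r > \<beta> r *
             sqrt (real (CARD('d) * CARD('l + 'f))
                   / lambda_min (follower_block (bearing_laplacian e pstar))) ^ (r + 1))
          \<and> 0 \<le> T \<and> (\<forall>r\<le>N. \<forall>k. beta_hat \<rho> (x T) r $ k > \<beta>bar r)" for \<beta>bar T
    proof (rule finite_time)
      show "0 \<le> T" using * by blast
      \<comment> \<open>The instance \<open>r = 0\<close> of the threshold, with exponent
        \<open>1\<close>.\<close>
      have "\<beta> 0 * rigidity_const ^ (0 + 1) < \<beta>bar 0" using * unfolding rigidity_const_def by blast
      then show "\<beta> 0 * rigidity_const < \<beta>bar 0" by simp
      show "\<beta>bar 0 < snd (x T) $ inv \<rho> 0 $ k" for k
        using * unfolding beta_hat_def by blast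
    qed
  qed
qed

end
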